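(* Fix $m\ge 2$, $\alpha\in[0,1)$ and $n$, and let $u=\frac{\alpha}{1-\alpha}$. Let $\psi_1=1$ and let $\psi_2,\ldots,\psi_n$ be independent random variables with $$\psi_j\sim\beta\bigl(m+2mu,\ (2j-3)m+2mu(j-1)\bigr).$$ Set $$\phi_j=\psi_j\prod_{i=j+1}^n(1-\psi_i),\qquad S_k=\sum_{j=1}^k\phi_j,\qquad I_k=[S_{k-1},S_k)$$ (with $S_0=0$). Conditioned on $\psi_1,\ldots,\psi_n$, choose $\{U_{k,i}\}_{k=1,\ldots,n,\ i=1,\ldots,m}$ as a family of independent random variables, with $U_{k,i}$ uniform on $[0,S_{k-1}]$. Join two vertices $j,k\in\{1,\ldots,n\}$ with $j<k$ if $U_{k,i}\in I_j$ for some $i\in\{1,\ldots,m\}$, with multiple edges between $j$ and $k$ if there are several such $i$ (one edge for each such $i$). Then the resulting random multigraph on $\{1,\ldots,n\}$ has the same distribution as the sequential preferential attachment graph $G_n$ with parameters $m$ and $\alpha$.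
   Context: $\beta(a,b)$ is the distribution on $[0,1]$ with density proportional to $x^{a-1}(1-x)^{b-1}$. Sequential preferential attachment graph. Fix an integer $m\ge2$ and $\alpha\in[0,1)$. $G_1$ has the single vertex $1$ and no edges; $G_2$ has vertices $1,2$ joined by $m$ edges. For $n\ge3$, given the multigraph $G_{n-1}$ on $\{1,\ldots,n-1\}$, the graph $G_n$ is obtained by adding the vertex $n$ and $m$ edges from $n$ to vertices $w_1,\ldots,w_m\in\{1,\ldots,n-1\}$ (repetitions allowed, giving multiple edges), chosen successively as follows. Given $G_{n-1}$ and $w_1,\ldots,w_{i-1}$: with probability $$\tilde\alpha=\alpha\,\frac{2m(n-1)}{2m(n-2)+2m\alpha+(1-\alpha)(i-1)}$$ $w_i$ is chosen uniformly from $\{1,\ldots,n-1\}$; with probability $1-\tilde\alpha$ it is chosen with $\mathbf P(w_i=k)=\deg'_{n-1}(k)/Z'$, where $\deg'_{n-1}(k)=\deg_{n-1}(k)+\#\{1\le j\le i-1: w_j=k\}$, $\deg_{n-1}(k)$ is the degree of $k$ in $G_{n-1}$ (counting multiplicities), and $Z'=\sum_{k=1}^{n-1}\deg'_{n-1}(k)=2m(n-2)+i-1$. *)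

theory Defs
  imports "HOL-Probability.Probability"
begin

text \<open>
  A loopless multigraph on the vertex set \<open>{1..n}\<close> is represented by the multiset of its edges,
  an edge between distinct vertices \<open>j\<close> and \<open>k\<close> being the set \<open>{j, k}\<close>.
\<close>

type_synonym multigraph = "nat set multiset"

definition deg :: "multigraph \<Rightarrow> nat \<Rightarrow> nat" where
  "deg G k = size {#e \<in># G. k \<in> e#}"


subsection \<open>The sequential preferential attachment graph\<close>

text \<open>
  In the definitions below \<open>n\<close> is the new vertex, \<open>G\<close> the graph on \<open>{1..n-1}\<close>, and \<open>ws\<close> the list
  \<open>[w\<^sub>1, \<dots>, w\<^bsub>i-1\<^esub>]\<close> of the endpoints chosen so far, so that \<open>i - 1 = length ws\<close>.
\<close>

definition deg' :: "multigraph \<Rightarrow> nat list \<Rightarrow> nat \<Rightarrow> nat" where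
  "deg' G ws k = deg G k + count_list ws k"

definition pref_pmf :: "nat \<Rightarrow> multigraph \<Rightarrow> nat list \<Rightarrow> nat pmf" where
  "pref_pmf n G ws =
     embed_pmf (\<lambda>k. if k \<in> {1..n-1}
       then real (deg' G ws k) / real (\<Sum>l\<in>{1..n-1}. deg' G ws l) else 0)"

text \<open>
  \<^const>\<open>embed_pmf\<close> is only meaningful for weights that sum to 1, which is the case here as soon as
  the normalising constant is positive.
\<close>

lemma pmf_pref_pmf:
  assumes "(\<Sum>l\<in>{1..n-1}. deg' G ws l) > 0"
  shows "pmf (pref_pmf n G ws) k =
    (if k \<in> {1..n-1} then real (deg' G ws k) / real (\<Sum>l\<in>{1..n-1}. deg' G ws l) else 0)"
proof -
  define Z where "Z = real (\<Sum>l\<in>{1..n-1}. deg' G ws l)"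
  have Z: "Z > 0" using assms unfolding Z_def by linarith
  let ?f = "\<lambda>k. if k \<in> {1..n-1} then real (deg' G ws k) / Z else 0"
  have "(\<integral>\<^sup>+k. ennreal (?f k) \<partial>count_space UNIV) = (\<Sum>k\<in>{1..n-1}. ennreal (?f k))"
    by (rule nn_integral_count_space') auto
  also have "\<dots> = ennreal (\<Sum>k\<in>{1..n-1}. ?f k)"
    using Z by (intro sum_ennreal) auto
  also have "(\<Sum>k\<in>{1..n-1}. ?f k) = (\<Sum>k\<in>{1..n-1}. real (deg' G ws k)) / Z"
    by (simp add: sum_divide_distrib)
  also have "\<dots> = 1" using Z by (simp add: Z_def)
  finally have "(\<integral>\<^sup>+k. ennreal (?f k) \<partial>count_space UNIV) = 1" by simp
  then show ?thesis
    unfolding pref_pmf_def Z_def[symmetric]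
    using Z by (subst pmf_embed_pmf) auto
qed

definition alpha_tilde :: "nat \<Rightarrow> real \<Rightarrow> nat \<Rightarrow> nat \<Rightarrow> real" where
  "alpha_tilde m \<alpha> n i =
     \<alpha> * (2 * real m * (real n - 1) /
       (2 * real m * (real n - 2) + 2 * real m * \<alpha> + (1 - \<alpha>) * (real i - 1)))"

definition endpoint_pmf :: "nat \<Rightarrow> real \<Rightarrow> nat \<Rightarrow> multigraph \<Rightarrow> nat list \<Rightarrow> nat pmf" where
  "endpoint_pmf m \<alpha> n G ws =
     bind_pmf (bernoulli_pmf (alpha_tilde m \<alpha> n (Suc (length ws))))
       (\<lambda>b. if b then pmf_of_set {1..n-1} else pref_pmf n G ws)"

primrec endpoints_pmf :: "nat \<Rightarrow> real \<Rightarrow> nat \<Rightarrow> multigraph \<Rightarrow> nat \<Rightarrow> nat list pmf" where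
  "endpoints_pmf m \<alpha> n G 0 = return_pmf []"
| "endpoints_pmf m \<alpha> n G (Suc i) =
     bind_pmf (endpoints_pmf m \<alpha> n G i)
       (\<lambda>ws. map_pmf (\<lambda>w. ws @ [w]) (endpoint_pmf m \<alpha> n G ws))"

text \<open>The value at \<open>n = 0\<close> is only there for totality.\<close>

fun seq_pa_graph :: "nat \<Rightarrow> real \<Rightarrow> nat \<Rightarrow> multigraph pmf" where
  "seq_pa_graph m \<alpha> 0 = return_pmf {#}"
| "seq_pa_graph m \<alpha> (Suc 0) = return_pmf {#}"
| "seq_pa_graph m \<alpha> (Suc (Suc 0)) = return_pmf (replicate_mset m {1, 2})"
| "seq_pa_graph m \<alpha> (Suc (Suc (Suc n'))) =
     (let n = Suc (Suc (Suc n')) in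
       bind_pmf (seq_pa_graph m \<alpha> (Suc (Suc n')))
         (\<lambda>G. map_pmf (\<lambda>ws. G + mset (map (\<lambda>w. {w, n}) ws)) (endpoints_pmf m \<alpha> n G m)))"


subsection \<open>The Polya urn graph\<close>

text \<open>The normalising constant is justified by \<open>has_integral_Beta_real\<close>.\<close>

definition beta_density :: "real \<Rightarrow> real \<Rightarrow> real \<Rightarrow> real" where
  "beta_density a b x =
     (if x \<in> {0..1} then x powr (a - 1) * (1 - x) powr (b - 1) / Beta a b else 0)"

definition urn_phi :: "nat \<Rightarrow> (nat \<Rightarrow> real) \<Rightarrow> nat \<Rightarrow> real" where
  "urn_phi n \<psi> j = \<psi> j * (\<Prod>i\<in>{j+1..n}. 1 - \<psi> i)"

definition urn_S :: "nat \<Rightarrow> (nat \<Rightarrow> real) \<Rightarrow> nat \<Rightarrow> real" where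
  "urn_S n \<psi> k = (\<Sum>j\<in>{1..k}. urn_phi n \<psi> j)"

definition urn_I :: "nat \<Rightarrow> (nat \<Rightarrow> real) \<Rightarrow> nat \<Rightarrow> real set" where
  "urn_I n \<psi> k = {urn_S n \<psi> (k - 1)..<urn_S n \<psi> k}"

definition urn_graph :: "nat \<Rightarrow> nat \<Rightarrow> (nat \<Rightarrow> real) \<Rightarrow> (nat \<Rightarrow> nat \<Rightarrow> real) \<Rightarrow> multigraph" where
  "urn_graph m n \<psi> U =
     image_mset (\<lambda>(j, k, i). {j, k})
       (mset_set {(j, k, i). j \<in> {1..n} \<and> k \<in> {1..n} \<and> i \<in> {1..m} \<and> j < k \<and>
                             U k i \<in> urn_I n \<psi> j})"

text \<open>
  The uniform distribution on \<open>[0, s]\<close>. For \<open>s = 0\<close>, which occurs for the variables \<open>U\<^bsub>1,i\<^esub>\<close>, it is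
  the point mass at \<open>0\<close>, whereas \<open>uniform_measure lborel {0..0}\<close> would be the zero measure.
\<close>

definition uniform_0_to :: "real \<Rightarrow> real measure" where
  "uniform_0_to s = (if s > 0 then uniform_measure lborel {0..s} else return borel 0)"

text \<open>
  \<open>has_cond_distr M N X L Y K\<close> says that, conditioned on the \<open>N\<close>-valued random variable \<open>X\<close>, the
  \<open>L\<close>-valued random variable \<open>Y\<close> has distribution \<open>K X\<close>: for every event \<open>B\<close> the function
  \<open>K (X \<omega>) B\<close> is a version of the conditional probability of \<open>Y \<in> B\<close> given the sigma-algebra
  generated by \<open>X\<close>.
\<close>

definition has_cond_distr ::
  "'a measure \<Rightarrow> 'b measure \<Rightarrow> ('a \<Rightarrow> 'b) \<Rightarrow> 'c measure \<Rightarrow> ('a \<Rightarrow> 'c) \<Rightarrow> ('b \<Rightarrow> 'c measure) \<Rightarrow> bool"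
where
  "has_cond_distr M N X L Y K \<longleftrightarrow>
     X \<in> measurable M N \<and> Y \<in> measurable M L \<and>
     (\<forall>B\<in>sets L. AE \<omega> in M.
        real_cond_exp M (vimage_algebra (space M) X N) (indicator (Y -` B \<inter> space M)) \<omega> =
        measure (K (X \<omega>)) B)"

end

theory Submission
  imports Defs
begin

text \<open>
  Both random graphs are images of a \<^emph>\<open>history\<close>: the list of the endpoints chosen by the \<open>m (n - 1)\<close>
  edges, in the order in which they are created. Slots are counted from \<open>0\<close>, so slot \<open>s\<close> belongs to
  the vertex \<open>2 + s div m\<close>. It is enough that each history has the same probability in both models.

  \<^emph>\<open>The urn model.\<close> Since \<open>\<psi>\<^sub>1 = 1\<close>, the sums telescope to \<open>S\<^sub>k = \<Prod>i>k. (1 - \<psi>\<^sub>i)\<close>. Hence, given \<open>\<psi>\<close>, an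
  edge of the vertex \<open>k\<close> ends at \<open>j < k\<close> with probability \<open>\<phi>\<^sub>j / S\<^bsub>k-1\<^esub> = \<psi>\<^sub>j \<Prod>j<i<k. (1 - \<psi>\<^sub>i)\<close>
  (\<open>urn_phi_ratio\<close>), independently of the other edges. Multiplying over all slots and collecting powers,
  a history has the conditional probability \<open>\<Prod>j. \<psi>\<^sub>j ^ A\<^sub>j * (1 - \<psi>\<^sub>j) ^ B\<^sub>j\<close> (\<open>prob_hits\<close>,
  \<open>prod_over_history\<close>), where \<open>A\<^sub>j\<close> edges end at \<open>j\<close> and \<open>B\<^sub>j\<close> edges pass over \<open>j\<close>, that is, start after
  \<open>j\<close> and end before \<open>j\<close>. By independence its unconditional probability is the product of the ratios
  \<open>Beta (a + A\<^sub>j) (b\<^sub>j + B\<^sub>j) / Beta a b\<^sub>j\<close> (\<open>nn_integral_beta_monomials\<close>).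

  \<^emph>\<open>The sequential model.\<close> With \<open>u = \<alpha> / (1 - \<alpha>)\<close>, the mixture of the uniform and the preferential choice
  is the choice of \<open>j\<close> with probability proportional to the single weight \<open>2 m u + deg' j\<close>
  (\<open>pmf_endpoint\<close>). The parameters of the beta distributions are such that \<open>a + A\<^sub>j\<close> is the current weight
  of \<open>j\<close>, and \<open>b\<^sub>j + B\<^sub>j\<close> is the total weight \<open>W\<^bsub>j-1\<^esub>\<close> of the vertices before \<open>j\<close> (\<open>cum_weight_older\<close>). So, by
  the functional equation of the Beta function, one more edge from \<open>k\<close> to \<open>w\<close> multiplies the product
  of Beta ratios by \<open>(weight w / W\<^sub>w) * \<Prod>w<j<k. (W\<^bsub>j-1\<^esub> / W\<^sub>j) = weight w / W\<^bsub>k-1\<^esub>\<close>, which is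
  exactly the transition probability of the sequential model (\<open>moment_snoc\<close>, \<open>pmf_history\<close>).

  One point of measure theory remains. The hypothesis on the conditional law of the marks \<open>U\<close> speaks
  about fixed events, but the intervals \<open>I\<^sub>j\<close> themselves depend on \<open>\<psi>\<close>. Writing the conditional law as the
  law of \<open>S\<^bsub>k-1\<^esub> * V\<close> with a family \<open>V\<close> of independent uniform variables on \<open>[0, 1]\<close> that does not depend
  on \<open>\<psi>\<close>, one obtains the joint law of \<open>\<psi>\<close> and \<open>U\<close> (\<open>joint_distr_of_cond_distr\<close>), and with it the
  probability of events that involve both.
\<close>

section \<open>Joint laws from conditional laws\<close>

text \<open>
  A one-sided comparison suffices because applying it to the complement reverses the inequality. This
  is how the two graph distributions are compared in the end: the events of the single histories give
  lower bounds for the probabilities in the urn model.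
\<close>

lemma prob_measure_eqI:
  assumes "prob_space P" "prob_space Q" "sets P = sets Q"
    and le: "\<And>X. X \<in> sets P \<Longrightarrow> measure Q X \<le> measure P X"
  shows "P = Q"
proof -
  interpret P: prob_space P by fact
  interpret Q: prob_space Q by fact
  have sp: "space P = space Q" using assms(3) by (rule sets_eq_imp_space_eq)
  have "measure P X = measure Q X" if X: "X \<in> sets P" for X
  proof -
    have "1 - measure Q X \<le> 1 - measure P X"
      using le[of "space P - X"] P.prob_compl[OF X] Q.prob_compl[of X] X assms(3) sp by simp
    with le[OF X] show ?thesis by simp
  qed
  then show ?thesis
    using assms(3) by (intro measure_eqI) (simp_all add: P.emeasure_eq_measure Q.emeasure_eq_measure)
qed

text \<open>
  The maps \<open>f i\<close> may differ from coordinate to coordinate, as they do for the marks: the scaling factor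
  \<open>S\<^bsub>k-1\<^esub>\<close> depends on the vertex \<open>k\<close>.
\<close>

lemma PiM_distr_finite:
  assumes fin: "finite I" and P: "\<And>i. i \<in> I \<Longrightarrow> prob_space (M i)"
    and f [measurable]: "\<And>i. i \<in> I \<Longrightarrow> f i \<in> measurable (M i) (N i)"
  shows "PiM I (\<lambda>i. distr (M i) (N i) (f i)) = distr (PiM I M) (PiM I N) (\<lambda>x. \<lambda>i\<in>I. f i (x i))"
proof -
  \<comment> \<open>Outside \<open>I\<close> the families are replaced by an arbitrary probability space, because a product
    probability space is a family that consists of probability spaces at every index.\<close>
  define M' where "M' = (\<lambda>i. if i \<in> I then M i else return (count_space UNIV) undefined)"
  define D where "D = (\<lambda>i. if i \<in> I then distr (M i) (N i) (f i) else return (count_space UNIV) undefined)"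
  interpret M': product_prob_space M'
    by (rule product_prob_spaceI) (auto simp: M'_def P intro!: prob_space_return)
  interpret D: product_prob_space D
    by (rule product_prob_spaceI)
      (auto simp: D_def P intro!: prob_space_return prob_space.prob_space_distr)
  have M': "PiM I M' = PiM I M" by (intro PiM_cong) (auto simp: M'_def)
  have D: "PiM I D = PiM I (\<lambda>i. distr (M i) (N i) (f i))" by (intro PiM_cong) (auto simp: D_def)
  have setsD: "sets (PiM I D) = sets (PiM I N)" by (intro sets_PiM_cong) (auto simp: D_def)
  have meas: "(\<lambda>x. \<lambda>i\<in>I. f i (x i)) \<in> measurable (PiM I M) (PiM I N)" by measurable
  have "distr (PiM I M) (PiM I N) (\<lambda>x. \<lambda>i\<in>I. f i (x i)) = PiM I D"
  proof (rule D.PiM_eqI[OF fin])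
    show "sets (distr (PiM I M) (PiM I N) (\<lambda>x. \<lambda>i\<in>I. f i (x i))) = sets (PiM I D)"
      by (simp add: setsD)
    fix A assume A: "\<And>i. i \<in> I \<Longrightarrow> A i \<in> sets (D i)"
    then have "Pi\<^sub>E I A \<in> sets (PiM I N)"
      unfolding setsD[symmetric] by (intro sets_PiM_I_finite fin)
    then have "emeasure (distr (PiM I M) (PiM I N) (\<lambda>x. \<lambda>i\<in>I. f i (x i))) (Pi\<^sub>E I A) =
        emeasure (PiM I M) ((\<lambda>x. \<lambda>i\<in>I. f i (x i)) -` Pi\<^sub>E I A \<inter> space (PiM I M))"
      by (intro emeasure_distr meas)
    also have "(\<lambda>x. \<lambda>i\<in>I. f i (x i)) -` Pi\<^sub>E I A \<inter> space (PiM I M) =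
        Pi\<^sub>E I (\<lambda>i. f i -` A i \<inter> space (M i))"
      by (auto simp: space_PiM PiE_def Pi_def extensional_def restrict_def)
    also have "emeasure (PiM I M) \<dots> = (\<Prod>i\<in>I. emeasure (M' i) (f i -` A i \<inter> space (M i)))"
      unfolding M'[symmetric] using A fin
      by (intro M'.emeasure_PiM) (auto simp: M'_def D_def intro!: measurable_sets[OF f])
    also have "\<dots> = (\<Prod>i\<in>I. emeasure (D i) (A i))"
      using A by (intro prod.cong) (auto simp: M'_def D_def emeasure_distr)
    finally show "emeasure (distr (PiM I M) (PiM I N) (\<lambda>x. \<lambda>i\<in>I. f i (x i))) (Pi\<^sub>E I A) =
        (\<Prod>i\<in>I. emeasure (D i) (A i))" .
  qed
  then show ?thesis by (simp add: D)
qed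

text \<open>
  A conditional law that is the image of a fixed probability space \<open>R\<close> under a jointly measurable map
  \<open>T\<close> is automatically a measurable kernel, and the joint law is the image of a product
  measure. On rectangles the equality is the defining property of conditional expectation, and
  rectangles generate the product sigma-algebra.
\<close>

lemma joint_distr_of_cond_distr:
  assumes M: "prob_space M" and R: "prob_space R"
    and cond: "has_cond_distr M N X L Y K"
    and T [measurable]: "(\<lambda>(p, v). T p v) \<in> measurable (N \<Otimes>\<^sub>M R) L"
    and K: "\<And>p. p \<in> space N \<Longrightarrow> K p = distr R L (T p)"
  shows "distr M (N \<Otimes>\<^sub>M L) (\<lambda>\<omega>. (X \<omega>, Y \<omega>)) =
    distr (distr M N X \<Otimes>\<^sub>M R) (N \<Otimes>\<^sub>M L) (\<lambda>(p, v). (p, T p v))"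
proof -
  interpret M: prob_space M by fact
  interpret R: prob_space R by fact
  have X [measurable]: "X \<in> measurable M N" and Y [measurable]: "Y \<in> measurable M L"
    and AE: "\<And>B. B \<in> sets L \<Longrightarrow> AE \<omega> in M.
        real_cond_exp M (vimage_algebra (space M) X N) (indicator (Y -` B \<inter> space M)) \<omega> =
        measure (K (X \<omega>)) B"
    using cond by (auto simp: has_cond_distr_def)
  interpret D: prob_space "distr M N X" by (rule M.prob_space_distr) measurable
  define F where "F = vimage_algebra (space M) X N"
  have "subalgebra M F"
    using measurable_space[OF X]
    by (auto simp: subalgebra_def F_def sets_vimage_algebra2 intro: measurable_sets[OF X])
  then interpret F: finite_measure_subalgebra M F by unfold_locales
  have TM: "(\<lambda>(p, v). (p, T p v)) \<in> measurable (N \<Otimes>\<^sub>M R) (N \<Otimes>\<^sub>M L)" by measurable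
  have sets_NR: "sets (distr M N X \<Otimes>\<^sub>M R) = sets (N \<Otimes>\<^sub>M R)"
    by (intro sets_pair_measure_cong) simp_all
  have TM': "(\<lambda>(p, v). (p, T p v)) \<in> measurable (distr M N X \<Otimes>\<^sub>M R) (N \<Otimes>\<^sub>M L)"
    using TM by (subst measurable_cong_sets[OF sets_NR refl])
  have Tp: "T p \<in> measurable R L" if "p \<in> space N" for p
    using measurable_Pair2[OF T that] by simp
  let ?L = "distr M (N \<Otimes>\<^sub>M L) (\<lambda>\<omega>. (X \<omega>, Y \<omega>))"
  let ?R = "distr (distr M N X \<Otimes>\<^sub>M R) (N \<Otimes>\<^sub>M L) (\<lambda>(p, v). (p, T p v))"
  interpret L: prob_space ?L by (rule M.prob_space_distr) measurable
  show ?thesis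
  proof (rule measure_eqI_generator_eq[OF Int_stable_pair_measure_generator[of N L]])
    show "{a \<times> b |a b. a \<in> sets N \<and> b \<in> sets L} \<subseteq> Pow (space N \<times> space L)"
      by (rule pair_measure_closed)
    show "sets ?L = sigma_sets (space N \<times> space L) {a \<times> b |a b. a \<in> sets N \<and> b \<in> sets L}"
      "sets ?R = sigma_sets (space N \<times> space L) {a \<times> b |a b. a \<in> sets N \<and> b \<in> sets L}"
      by (simp_all add: sets_pair_measure)
    show "range (\<lambda>_. space N \<times> space L) \<subseteq> {a \<times> b |a b. a \<in> sets N \<and> b \<in> sets L}"
      using sets.top[of N] sets.top[of L] by blast
    show "(\<Union>i::nat. space N \<times> space L) = space N \<times> space L" by auto
    show "emeasure ?L (space N \<times> space L) \<noteq> \<infinity>" by simp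
    fix C assume "C \<in> {a \<times> b |a b. a \<in> sets N \<and> b \<in> sets L}"
    then obtain A B where C: "C = A \<times> B" and [measurable]: "A \<in> sets N" "B \<in> sets L" by auto
    define A' where "A' = X -` A \<inter> space M"
    have A'F: "A' \<in> sets F" unfolding A'_def F_def by (rule in_vimage_algebra) fact
    have A' [measurable]: "A' \<in> sets M" unfolding A'_def by measurable
    have B' [measurable]: "Y -` B \<inter> space M \<in> sets M" by measurable
    define g where "g p = measure R {v \<in> space R. T p v \<in> B}" for p
    have slice: "{v \<in> space R. T p v \<in> B} = Pair p -` {x \<in> space (N \<Otimes>\<^sub>M R). (case x of (p, v) \<Rightarrow> T p v) \<in> B}"
      if "p \<in> space N" for p using that by (auto simp: space_pair_measure)
    have "{x \<in> space (N \<Otimes>\<^sub>M R). (case x of (p, v) \<Rightarrow> T p v) \<in> B} \<in> sets (N \<Otimes>\<^sub>M R)" by measurable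
    from R.measurable_emeasure_Pair[OF this]
    have "(\<lambda>p. emeasure R {v \<in> space R. T p v \<in> B}) \<in> borel_measurable N"
      by (rule measurable_cong[THEN iffD1, rotated]) (simp add: slice)
    then have g [measurable]: "g \<in> borel_measurable N"
      unfolding g_def measure_def by (rule borel_measurable_enn2real)
    have g1: "0 \<le> g p" "g p \<le> 1" for p by (auto simp: g_def)
    have Kg: "measure (K (X \<omega>)) B = g (X \<omega>)" if "\<omega> \<in> space M" for \<omega>
    proof -
      have p: "X \<omega> \<in> space N" using that measurable_space[OF X] by blast
      have "T (X \<omega>) \<in> measurable R L" using p by (rule Tp)
      then have "measure (K (X \<omega>)) B = measure R (T (X \<omega>) -` B \<inter> space R)"
        unfolding K[OF p] by (rule measure_distr) fact
      also have "T (X \<omega>) -` B \<inter> space R = {v \<in> space R. T (X \<omega>) v \<in> B}" by auto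
      finally show ?thesis unfolding g_def .
    qed
    have "emeasure ?L C = ennreal (measure M ((Y -` B \<inter> space M) \<inter> A'))"
      by (subst emeasure_distr) (auto simp: C A'_def M.emeasure_eq_measure intro!: arg_cong[where f = "measure M"])
    also have "measure M ((Y -` B \<inter> space M) \<inter> A') =
        (\<integral>\<omega>\<in>A'. indicator (Y -` B \<inter> space M) \<omega> \<partial>M)"
      unfolding set_lebesgue_integral_def real_scaleR_def indicator_inter_arith[symmetric]
      by (simp add: Int_ac)
    also have "\<dots> = (\<integral>\<omega>\<in>A'. real_cond_exp M F (indicator (Y -` B \<inter> space M)) \<omega> \<partial>M)"
      by (intro F.real_cond_exp_intA integrable_real_indicator A'F) (auto simp: M.emeasure_eq_measure)
    also have "\<dots> = (\<integral>\<omega>\<in>A'. g (X \<omega>) \<partial>M)"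
      using AE[of B, folded F_def]
      by (intro set_lebesgue_integral_cong_AE) (auto simp: Kg)
    also have "ennreal \<dots> = (\<integral>\<^sup>+\<omega>. ennreal (indicator A' \<omega> * g (X \<omega>)) \<partial>M)"
      unfolding set_lebesgue_integral_def real_scaleR_def
      by (intro nn_integral_eq_integral[symmetric] M.integrable_const_bound[where B = 1])
        (auto simp: g1 split: split_indicator)
    also have "\<dots> = (\<integral>\<^sup>+\<omega>. indicator A (X \<omega>) * ennreal (g (X \<omega>)) \<partial>M)"
      by (intro nn_integral_cong) (auto simp: A'_def split: split_indicator)
    also have "\<dots> = (\<integral>\<^sup>+p. indicator A p * ennreal (g p) \<partial>distr M N X)"
      by (subst nn_integral_distr) auto
    also have "\<dots> = (\<integral>\<^sup>+p. \<integral>\<^sup>+v. indicator C (p, T p v) \<partial>R \<partial>distr M N X)"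
    proof (intro nn_integral_cong, goal_cases)
      case (1 p)
      then have p: "p \<in> space N" by simp
      note [measurable] = Tp[OF p]
      have "(\<integral>\<^sup>+v. indicator C (p, T p v) \<partial>R) = (\<integral>\<^sup>+v. indicator A p * indicator {v \<in> space R. T p v \<in> B} v \<partial>R)"
        by (intro nn_integral_cong) (auto simp: C split: split_indicator)
      also have "\<dots> = indicator A p * ennreal (g p)"
        by (subst nn_integral_cmult_indicator) (auto simp: g_def R.emeasure_eq_measure)
      finally show ?case ..
    qed
    also have "\<dots> = (\<integral>\<^sup>+x. indicator C (case x of (p, v) \<Rightarrow> (p, T p v)) \<partial>(distr M N X \<Otimes>\<^sub>M R))"
    proof -
      have "(\<lambda>x. indicator C (case x of (p, v) \<Rightarrow> (p, T p v)) :: ennreal) \<in> borel_measurable (N \<Otimes>\<^sub>M R)"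
        by (rule measurable_compose[OF TM]) (simp add: C)
      then have "(\<lambda>x. indicator C (case x of (p, v) \<Rightarrow> (p, T p v)) :: ennreal) \<in> borel_measurable (distr M N X \<Otimes>\<^sub>M R)"
        by (subst measurable_cong_sets[OF sets_NR refl])
      from R.nn_integral_fst[OF this] show ?thesis by simp
    qed
    also have "\<dots> = (\<integral>\<^sup>+x. indicator C x \<partial>?R)"
      by (subst nn_integral_distr[OF TM']) (simp_all add: C)
    also have "\<dots> = emeasure ?R C" by (simp add: C)
    finally show "emeasure ?L C = emeasure ?R C" .
  qed
qed

text \<open>
  This is the form in which the joint law is used: the event may depend on the conditioning variable,
  whose value is inserted before the conditional probability is taken.
\<close>

lemma emeasure_of_cond_distr:
  assumes M: "prob_space M" and R: "prob_space R"
    and cond: "has_cond_distr M N X L Y K"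
    and T: "(\<lambda>(p, v). T p v) \<in> measurable (N \<Otimes>\<^sub>M R) L"
    and K: "\<And>p. p \<in> space N \<Longrightarrow> K p = distr R L (T p)"
    and C: "C \<in> sets (N \<Otimes>\<^sub>M L)"
  shows "emeasure M {\<omega> \<in> space M. (X \<omega>, Y \<omega>) \<in> C} =
    (\<integral>\<^sup>+\<omega>. emeasure R {v \<in> space R. (X \<omega>, T (X \<omega>) v) \<in> C} \<partial>M)"
proof -
  interpret R: prob_space R by fact
  have X: "X \<in> measurable M N" and Y: "Y \<in> measurable M L"
    using cond by (auto simp: has_cond_distr_def)
  define g where "g = (\<lambda>(p, v). (p, T p v))"
  have g: "g \<in> measurable (N \<Otimes>\<^sub>M R) (N \<Otimes>\<^sub>M L)"
    using measurable_Pair[OF measurable_fst T] by (simp add: split_def g_def)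
  have sets_NR: "sets (distr M N X \<Otimes>\<^sub>M R) = sets (N \<Otimes>\<^sub>M R)"
    by (intro sets_pair_measure_cong) simp_all
  let ?D = "g -` C \<inter> space (N \<Otimes>\<^sub>M R)"
  have D: "?D \<in> sets (N \<Otimes>\<^sub>M R)" by (rule measurable_sets[OF g C])
  have slice: "Pair p -` ?D = {v \<in> space R. (p, T p v) \<in> C}" if "p \<in> space N" for p
    using that by (auto simp: g_def space_pair_measure)
  have "emeasure M {\<omega> \<in> space M. (X \<omega>, Y \<omega>) \<in> C} = emeasure (distr M (N \<Otimes>\<^sub>M L) (\<lambda>\<omega>. (X \<omega>, Y \<omega>))) C"
    using emeasure_distr[OF measurable_Pair[OF X Y] C] by (simp add: vimage_def Int_def conj_commute)
  also have "\<dots> = emeasure (distr (distr M N X \<Otimes>\<^sub>M R) (N \<Otimes>\<^sub>M L) g) C"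
    unfolding g_def by (simp only: joint_distr_of_cond_distr[OF M R cond T K])
  also have "\<dots> = emeasure (distr M N X \<Otimes>\<^sub>M R) ?D"
    using g C by (subst emeasure_distr) (simp_all add: measurable_cong_sets[OF sets_NR refl] space_pair_measure)
  also have "\<dots> = (\<integral>\<^sup>+p. emeasure R (Pair p -` ?D) \<partial>distr M N X)"
    by (rule R.emeasure_pair_measure_alt) (simp add: sets_NR D)
  also have "\<dots> = (\<integral>\<^sup>+\<omega>. emeasure R (Pair (X \<omega>) -` ?D) \<partial>M)"
    using R.measurable_emeasure_Pair[OF D] X by (intro nn_integral_distr) simp_all
  also have "\<dots> = (\<integral>\<^sup>+\<omega>. emeasure R {v \<in> space R. (X \<omega>, T (X \<omega>) v) \<in> C} \<partial>M)"
    by (intro nn_integral_cong arg_cong[where f = "emeasure R"] slice measurable_space[OF X])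
  finally show ?thesis .
qed

section \<open>Uniform and beta variables\<close>

abbreviation unif01 :: "real measure" where
  "unif01 \<equiv> uniform_measure lborel {0..1}"

lemma prob_space_unif01: "prob_space unif01"
  by (rule prob_space_uniform_measure) auto

text \<open>
  The truncation \<open>max 0 s\<close> makes the equation hold for all \<open>s\<close>: for \<open>s \<le> 0\<close> both sides are the point
  mass at \<open>0\<close>.
\<close>

lemma uniform_0_to_eq_scaled: "uniform_0_to s = distr unif01 borel (\<lambda>x. max 0 s * x)"
proof (cases "s > 0")
  case True
  show ?thesis
  proof (rule measure_eqI)
    fix A assume "A \<in> sets (uniform_0_to s)"
    then have A [measurable]: "A \<in> sets borel" using True by (simp add: uniform_0_to_def)
    have "emeasure (distr unif01 borel (\<lambda>x. max 0 s * x)) A =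
        emeasure unif01 ((\<lambda>x. s * x) -` A)"
      using True by (subst emeasure_distr) (simp_all add: max_def)
    also have "\<dots> = emeasure lborel ({0..1} \<inter> ((\<lambda>x. s * x) -` A))"
    proof -
      have "(\<lambda>x. s * x) -` A \<in> sets borel"
        using measurable_sets[of "\<lambda>x. s * x" borel borel A] A by simp
      then show ?thesis by (subst emeasure_uniform_measure) (simp_all add: divide_ennreal_def)
    qed
    also have "\<dots> = (\<integral>\<^sup>+x. indicator ({0..s} \<inter> A) (0 + s * x) \<partial>lborel)"
    proof -
      have "(\<lambda>x. s * x) -` A \<in> sets borel"
        using measurable_sets[of "\<lambda>x. s * x" borel borel A] A by simp
      then have "emeasure lborel ({0..1} \<inter> ((\<lambda>x. s * x) -` A)) =
          (\<integral>\<^sup>+x. indicator ({0..1} \<inter> ((\<lambda>x. s * x) -` A)) x \<partial>lborel)"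
        by (subst nn_integral_indicator) auto
      also have "\<dots> = (\<integral>\<^sup>+x. indicator ({0..s} \<inter> A) (0 + s * x) \<partial>lborel)"
        using True
        by (intro nn_integral_cong) (auto simp: mult_le_cancel_left1 zero_le_mult_iff split: split_indicator)
      finally show ?thesis .
    qed
    also have "\<dots> = emeasure lborel ({0..s} \<inter> A) / ennreal s"
    proof -
      have "emeasure lborel ({0..s} \<inter> A) = (\<integral>\<^sup>+x. indicator ({0..s} \<inter> A) x \<partial>lborel)"
        by simp
      also have "\<dots> = ennreal s * (\<integral>\<^sup>+x. indicator ({0..s} \<inter> A) (0 + s * x) \<partial>lborel)"
        using True by (subst nn_integral_real_affine[where c = s and t = 0]) auto
      finally show ?thesis
        using True by (simp add: ennreal_mult_divide_eq mult.commute[of "ennreal s"])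
    qed
    also have "\<dots> = emeasure (uniform_0_to s) A"
      using True by (simp add: uniform_0_to_def)
    finally show "emeasure (uniform_0_to s) A = emeasure (distr unif01 borel (\<lambda>x. max 0 s * x)) A" ..
  qed (use True in \<open>simp add: uniform_0_to_def\<close>)
next
  case False
  interpret prob_space unif01 by (rule prob_space_unif01)
  from False show ?thesis
    by (simp add: uniform_0_to_def max_def)
qed

lemma measure_unif01_scaled_interval:
  assumes "0 \<le> a" "a \<le> b" "b \<le> c" "0 < c"
  shows "measure unif01 {y. c * y \<in> {a..<b}} = (b - a) / c"
proof -
  have "{y. c * y \<in> {a..<b}} = {a / c..<b / c}"
    using assms by (auto simp: field_simps)
  moreover have "{0..1} \<inter> {a / c..<b / c} = {a / c..<b / c}"
  proof -
    have "0 \<le> a / c" "b / c \<le> 1" using assms by simp_all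
    then show ?thesis by auto
  qed
  moreover have "measure unif01 {a / c..<b / c} = measure lborel ({0..1} \<inter> {a / c..<b / c}) / measure lborel {0..1::real}"
    by (rule measure_uniform_measure) auto
  ultimately show ?thesis
    using assms by (simp add: divide_right_mono diff_divide_distrib)
qed

lemma Beta_step_left:
  assumes "a > 0" "b > (0::real)" shows "Beta (a + 1) b = a / (a + b) * Beta a b"
proof -
  have "a \<notin> \<int>\<^sub>\<le>\<^sub>0" using assms by (auto elim!: nonpos_Ints_cases)
  from Beta_plus1_left[OF this, of b] show ?thesis using assms by (simp add: field_simps)
qed

lemma Beta_step_right:
  assumes "a > 0" "b > (0::real)" shows "Beta a (b + 1) = b / (a + b) * Beta a b"
  using Beta_step_left[OF assms(2,1)] by (simp add: Beta_commute add.commute)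

lemma Beta_pos: "a > 0 \<Longrightarrow> b > 0 \<Longrightarrow> Beta a b > (0::real)"
  by (simp add: Beta_def)

lemma nn_integral_Beta_density:
  assumes a: "a > 0" and b: "b > (0::real)"
  shows "(\<integral>\<^sup>+x. ennreal (beta_density a b x) * ennreal (x ^ k * (1 - x) ^ l) \<partial>lborel) =
    ennreal (Beta (a + real k) (b + real l) / Beta a b)"
proof -
  let ?f = "\<lambda>t. if t \<in> {0..1} then t powr (a + k - 1) * (1 - t) powr (b + l - 1) / Beta a b else 0"
  have pos: "Beta a b > 0" using a b by (simp add: Beta_def)
  \<comment> \<open>For \<open>x \<in> {0, 1}\<close> both sides vanish, even if \<open>k = 0\<close> or \<open>l = 0\<close>, since \<open>0 powr c = 0\<close>.\<close>
  have eq: "beta_density a b x * (x ^ k * (1 - x) ^ l) = ?f x" for x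
  proof (cases "x \<in> {0<..<1}")
    case True
    then have "x powr (a + k - 1) = x powr (a - 1) * x ^ k" "(1 - x) powr (b + l - 1) = (1 - x) powr (b - 1) * (1 - x) ^ l"
      by (simp_all add: powr_add[symmetric] powr_realpow[symmetric] algebra_simps)
    with True show ?thesis by (simp add: beta_density_def)
  next
    case False
    then have "x = 0 \<or> x = 1 \<or> x \<notin> {0..1}" by auto
    then show ?thesis by (auto simp: beta_density_def)
  qed
  have "((\<lambda>t. t powr (a + k - 1) * (1 - t) powr (b + l - 1) / Beta a b) has_integral
      Beta (a + k) (b + l) / Beta a b) {0..1}"
    using a b by (intro has_integral_divide has_integral_Beta_real) auto
  then have I: "(?f has_integral Beta (a + k) (b + l) / Beta a b) UNIV"
    by (simp only: has_integral_restrict_UNIV)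
  have nn: "0 \<le> beta_density a b x" for x using pos by (simp add: beta_density_def)
  have "(\<integral>\<^sup>+x. ennreal (beta_density a b x) * ennreal (x ^ k * (1 - x) ^ l) \<partial>lborel) = (\<integral>\<^sup>+x. ennreal (?f x) \<partial>lborel)"
    unfolding eq[symmetric] using nn by (intro nn_integral_cong) (simp add: ennreal_mult')
  also have "\<dots> = ennreal (Beta (a + k) (b + l) / Beta a b)"
    using pos by (intro nn_integral_has_integral_lborel[OF _ _ I]) auto
  finally show ?thesis .
qed

lemma (in prob_space) nn_integral_beta_monomials:
  assumes indep: "indep_vars (\<lambda>_. borel) \<psi> I" and fin: "finite I"
    and beta: "\<And>j. j \<in> I \<Longrightarrow> distributed M lborel (\<psi> j) (\<lambda>x. ennreal (beta_density (a j) (b j) x))"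
    and pos: "\<And>j. j \<in> I \<Longrightarrow> a j > 0" "\<And>j. j \<in> I \<Longrightarrow> b j > 0"
  shows "(\<integral>\<^sup>+\<omega>. (\<Prod>j\<in>I. ennreal (\<psi> j \<omega> ^ A j * (1 - \<psi> j \<omega>) ^ B j)) \<partial>M) =
    ennreal (\<Prod>j\<in>I. Beta (a j + real (A j)) (b j + real (B j)) / Beta (a j) (b j))"
proof -
  have "indep_vars (\<lambda>_. borel) (\<lambda>j \<omega>. ennreal (\<psi> j \<omega> ^ A j * (1 - \<psi> j \<omega>) ^ B j)) I"
    by (rule indep_vars_compose2[OF indep, where Y = "\<lambda>j x. ennreal (x ^ A j * (1 - x) ^ B j)"]) measurable
  then have "(\<integral>\<^sup>+\<omega>. (\<Prod>j\<in>I. ennreal (\<psi> j \<omega> ^ A j * (1 - \<psi> j \<omega>) ^ B j)) \<partial>M) =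
      (\<Prod>j\<in>I. \<integral>\<^sup>+\<omega>. ennreal (\<psi> j \<omega> ^ A j * (1 - \<psi> j \<omega>) ^ B j) \<partial>M)"
    by (intro indep_vars_nn_integral fin) auto
  also have "\<dots> = (\<Prod>j\<in>I. ennreal (Beta (a j + real (A j)) (b j + real (B j)) / Beta (a j) (b j)))"
  proof (intro prod.cong refl)
    fix j assume j: "j \<in> I"
    have "(\<integral>\<^sup>+\<omega>. ennreal (\<psi> j \<omega> ^ A j * (1 - \<psi> j \<omega>) ^ B j) \<partial>M) =
        (\<integral>\<^sup>+x. ennreal (beta_density (a j) (b j) x) * ennreal (x ^ A j * (1 - x) ^ B j) \<partial>lborel)"
      by (rule distributed_nn_integral[OF beta[OF j], symmetric]) measurable
    then show "(\<integral>\<^sup>+\<omega>. ennreal (\<psi> j \<omega> ^ A j * (1 - \<psi> j \<omega>) ^ B j) \<partial>M) =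
        ennreal (Beta (a j + real (A j)) (b j + real (B j)) / Beta (a j) (b j))"
      using nn_integral_Beta_density[OF pos(1)[OF j] pos(2)[OF j]] by simp
  qed
  also have "\<dots> = ennreal (\<Prod>j\<in>I. Beta (a j + real (A j)) (b j + real (B j)) / Beta (a j) (b j))"
    using pos
    by (intro prod_ennreal divide_nonneg_nonneg Beta_pos[THEN less_imp_le] add_pos_nonneg) auto
  finally show ?thesis .
qed

text \<open>
  At the endpoints \<open>0\<close> and \<open>1\<close> the density vanishes, whatever the parameters, because \<open>0 powr c = 0\<close>.
\<close>

lemma (in prob_space) AE_beta_interior:
  assumes "distributed M lborel X (\<lambda>x. ennreal (beta_density a b x))"
  shows "AE \<omega> in M. 0 < X \<omega> \<and> X \<omega> < 1"
proof -
  have "0 < x \<and> x < 1" if "0 < ennreal (beta_density a b x)" for x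
  proof -
    have "x \<in> {0..1}" using that by (auto simp: beta_density_def split: if_splits)
    moreover have "x \<noteq> 0" "x \<noteq> 1" using that by (auto simp: beta_density_def)
    ultimately show ?thesis by auto
  qed
  then have "AE x in lborel. 0 < ennreal (beta_density a b x) \<longrightarrow> 0 < x \<and> x < 1" by auto
  then show ?thesis
    using distributed_AE2[OF assms, of "\<lambda>x. 0 < x \<and> x < 1"] by simp
qed

section \<open>Histories and their weights\<close>

definition source_vertex :: "nat \<Rightarrow> nat \<Rightarrow> nat" where
  "source_vertex m s = 2 + s div m"

definition history_graph :: "nat \<Rightarrow> nat list \<Rightarrow> multigraph" where
  "history_graph m ws = mset (map (\<lambda>s. {ws ! s, source_vertex m s}) [0..<length ws])"

definition admissible :: "nat \<Rightarrow> nat list \<Rightarrow> bool" where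
  "admissible m ws \<longleftrightarrow> (\<forall>s<length ws. 1 \<le> ws ! s \<and> ws ! s < source_vertex m s)"

text \<open>
  The exponent \<open>B\<^sub>j\<close> of \<open>1 - \<psi>\<^sub>j\<close> in the conditional probability of a history.
\<close>

definition overjumps :: "nat \<Rightarrow> nat list \<Rightarrow> nat \<Rightarrow> nat" where
  "overjumps m ws j = card {s. s < length ws \<and> ws ! s < j \<and> j < source_vertex m s}"

text \<open>
  This is \<open>2 m u + deg' j\<close>, expressed through the history. A vertex \<open>j \<ge> 2\<close> whose edges are all drawn has \<open>m\<close> of its own
  and one more for every occurrence of \<open>j\<close> as an endpoint; the vertex \<open>1\<close> has no edges of its own.
\<close>

definition weight :: "nat \<Rightarrow> real \<Rightarrow> nat list \<Rightarrow> nat \<Rightarrow> real" where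
  "weight m u ws j = 2 * real m * u + (if j \<ge> 2 then real m else 0) + real (count_list ws j)"

definition cum_weight :: "nat \<Rightarrow> real \<Rightarrow> nat list \<Rightarrow> nat \<Rightarrow> real" where
  "cum_weight m u ws l = (\<Sum>j\<in>{1..l}. weight m u ws j)"

lemma admissible_Nil [simp]: "admissible m []"
  by (simp add: admissible_def)

lemma admissible_snoc:
  "admissible m (ws @ [w]) \<longleftrightarrow> admissible m ws \<and> 1 \<le> w \<and> w < source_vertex m (length ws)"
  by (auto simp: admissible_def nth_append less_Suc_eq)

lemma admissible_prefix: "admissible m (xs @ ys) \<Longrightarrow> admissible m xs"
  by (auto simp: admissible_def nth_append) (metis trans_less_add1)+

lemma source_vertex_le:
  assumes "s < m * (n - 1)" shows "source_vertex m s \<le> n"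
  using less_mult_imp_div_less[of s "n - 1" m] assms by (simp add: source_vertex_def mult.commute)

lemma overjumps_Nil [simp]: "overjumps m [] j = 0"
  by (simp add: overjumps_def)

lemma overjumps_snoc:
  "overjumps m (ws @ [w]) j = overjumps m ws j + (if w < j \<and> j < source_vertex m (length ws) then 1 else 0)"
proof -
  have "{s. s < length (ws @ [w]) \<and> (ws @ [w]) ! s < j \<and> j < source_vertex m s} =
      {s. s < length ws \<and> ws ! s < j \<and> j < source_vertex m s} \<union>
      (if w < j \<and> j < source_vertex m (length ws) then {length ws} else {})"
    by (auto simp: nth_append less_Suc_eq)
  then show ?thesis
    by (simp add: overjumps_def)
qed

lemma history_graph_append:
  "history_graph m (H @ ws) =
    history_graph m H + mset (map (\<lambda>s. {ws ! s, source_vertex m (length H + s)}) [0..<length ws])"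
proof -
  have "[0..<length H + length ws] = [0..<length H] @ map (\<lambda>s. s + length H) [0..<length ws]"
    by (metis add.left_neutral add.commute map_add_upt upt_add_eq_append zero_le)
  then show ?thesis
    by (auto simp: history_graph_def nth_append add.commute
        intro!: image_mset_cong arg_cong2[where f = "(+)"])
qed

lemma history_graph_append_block:
  assumes "length H = m * d" "length ws = m"
  shows "history_graph m (H @ ws) = history_graph m H + mset (map (\<lambda>w. {w, d + 2}) ws)"
proof -
  have "map (\<lambda>s. {ws ! s, source_vertex m (length H + s)}) [0..<length ws] = map (\<lambda>w. {w, d + 2}) ws"
    using assms by (intro nth_equalityI) (auto simp: source_vertex_def)
  then show ?thesis
    by (simp only: history_graph_append)
qed

text \<open>
  By admissibility no edge has the same vertex at both ends, so the incidences as an endpoint and as a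
  source never concern the same edge.
\<close>

lemma deg_history_graph_aux:
  assumes "admissible m H"
  shows "deg (history_graph m H) j = count_list H j + card {s. s < length H \<and> source_vertex m s = j}"
  using assms
proof (induction H rule: rev_induct)
  case Nil
  then show ?case by (simp add: deg_def history_graph_def)
next
  case (snoc w H)
  then have v: "admissible m H" "1 \<le> w" "w < source_vertex m (length H)"
    by (auto simp: admissible_snoc)
  have c: "{s. s < length (H @ [w]) \<and> source_vertex m s = j} =
     {s. s < length H \<and> source_vertex m s = j} \<union> (if source_vertex m (length H) = j then {length H} else {})"
    by (auto simp: less_Suc_eq)
  show ?case
    unfolding c using snoc.IH[OF v(1)] v(2,3)
    by (auto simp: history_graph_append deg_def)
qed

lemma div_eq_set:
  assumes "m > (0::nat)" shows "{s. s div m = d} = {m * d..<m * Suc d}"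
  using assms by (auto simp: div_nat_eqI mult.commute dividend_less_times_div)

lemma deg_history_graph:
  assumes "admissible m H" "m > 0" "k \<ge> 3" "length H = m * (k - 2)" "1 \<le> j" "j < k"
  shows "deg (history_graph m H) j = (if j \<ge> 2 then m else 0) + count_list H j"
proof -
  have "card {s. s < length H \<and> source_vertex m s = j} = (if j \<ge> 2 then m else 0)"
  proof (cases "j \<ge> 2")
    case True
    have "m * Suc (j - 2) \<le> m * (k - 2)"
      using True assms by (intro mult_left_mono) auto
    moreover have "source_vertex m s = j \<longleftrightarrow> s div m = j - 2" for s
      using True by (auto simp: source_vertex_def)
    moreover have "s < m * Suc (j - 2)" if "s div m = j - 2" for s
      using div_eq_set[OF assms(2), of "j - 2"] that by auto
    ultimately have "{s. s < length H \<and> source_vertex m s = j} = {s. s div m = j - 2}"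
      using assms(4) by fastforce
    then show ?thesis
      using True assms by (simp add: div_eq_set)
  next
    case False
    then show ?thesis by (auto simp: source_vertex_def)
  qed
  then show ?thesis
    by (simp add: deg_history_graph_aux[OF assms(1)])
qed

text \<open>
  An edge that ends before \<open>l\<close> either starts after \<open>l\<close>, and then it passes over \<open>l\<close>, or it is one of the
  first \<open>m (l - 1)\<close> edges, which start at one of the vertices \<open>2, \<dots>, l\<close> and hence all end before \<open>l\<close>.
\<close>

lemma sum_count_list_history:
  assumes "admissible m ws" "m > 0" "l \<ge> 1"
  shows "(\<Sum>j\<in>{1..l-1}. count_list ws j) = overjumps m ws l + min (length ws) (m * (l - 1))"
  using assms(1)
proof (induction ws rule: rev_induct)
  case Nil
  then show ?case by simp
next
  case (snoc w ws)
  then have v: "admissible m ws" "1 \<le> w" "w < source_vertex m (length ws)"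
    by (auto simp: admissible_snoc)
  have "(\<Sum>j\<in>{1..l-1}. count_list (ws @ [w]) j) =
      (\<Sum>j\<in>{1..l-1}. count_list ws j) + (\<Sum>j\<in>{1..l-1}. if w = j then 1 else 0)"
    unfolding sum.distrib[symmetric] by (intro sum.cong) auto
  also have "(\<Sum>j\<in>{1..l-1}. if w = j then 1 else 0) = (if w < l then 1 else (0::nat))"
    using v assms(3) by (subst sum.delta') auto
  finally have *: "(\<Sum>j\<in>{1..l-1}. count_list (ws @ [w]) j) =
      overjumps m ws l + min (length ws) (m * (l - 1)) + (if w < l then 1 else 0)"
    using snoc.IH[OF v(1)] by simp
  have "length ws < m * (l - 1) \<longleftrightarrow> \<not> l < source_vertex m (length ws)"
  proof -
    have "length ws < m * (l - 1) \<longleftrightarrow> length ws div m < l - 1"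
      using assms(2) by (simp add: div_less_iff_less_mult mult.commute)
    then show ?thesis
      unfolding source_vertex_def by linarith
  qed
  with * v(3) show ?case
    by (auto simp: overjumps_snoc)
qed

lemma sum_const_weights:
  assumes "k \<ge> 2"
  shows "(\<Sum>j\<in>{1..k-1}. if j \<ge> 2 then real m else 0) = real m * (real k - 2)"
proof -
  have "(\<Sum>j\<in>{1..k-1}. if j \<ge> 2 then real m else 0) = (\<Sum>j\<in>{2..k-1}. real m)"
    by (intro sum.mono_neutral_cong_right) auto
  then show ?thesis
    using assms by (simp add: of_nat_diff algebra_simps)
qed

lemma cum_weight_eq:
  assumes "admissible m ws" "m > 0" "l \<ge> 2"
  shows "cum_weight m u ws (l - 1) =
    2 * real m * u * (real l - 1) + real m * (real l - 2) + real (overjumps m ws l)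
      + real (min (length ws) (m * (l - 1)))"
proof -
  have "cum_weight m u ws (l - 1) =
     (\<Sum>j\<in>{1..l-1}. 2 * real m * u) + (\<Sum>j\<in>{1..l-1}. if j \<ge> 2 then real m else 0) +
     real (\<Sum>j\<in>{1..l-1}. count_list ws j)"
    by (simp add: cum_weight_def weight_def sum.distrib)
  also have "\<dots> = 2 * real m * u * (real l - 1) + real m * (real l - 2) + real (overjumps m ws l)
      + real (min (length ws) (m * (l - 1)))"
    using assms by (simp only: sum_const_weights sum_count_list_history) (simp add: of_nat_diff algebra_simps)
  finally show ?thesis .
qed

text \<open>
  The right-hand side is \<open>b\<^sub>l + B\<^sub>l\<close>, with \<open>b\<^sub>l\<close> the second parameter of the beta distribution of \<open>\<psi>\<^sub>l\<close>.
  This is where the choice of \<open>b\<^sub>l\<close> comes from. The identity needs all edges of the vertex \<open>l\<close> to be present.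
\<close>

lemma cum_weight_older:
  assumes "admissible m ws" "m > 0" "l \<ge> 2" "m * (l - 1) \<le> length ws"
  shows "cum_weight m u ws (l - 1) =
    (2 * real l - 3) * real m + 2 * real m * u * (real l - 1) + real (overjumps m ws l)"
  using cum_weight_eq[OF assms(1-3), of u] assms(3,4)
  by (simp add: of_nat_diff algebra_simps min_absorb2)

lemma overjumps_at_current_vertex:
  assumes "length ws \<le> m * (k - 1)" "k \<ge> 2"
  shows "overjumps m ws k = 0"
proof -
  have "\<not> k < source_vertex m s" if "s < length ws" for s
    using less_mult_imp_div_less[of s "k - 1" m] that assms
    by (auto simp: source_vertex_def mult.commute)
  then show ?thesis
    by (auto simp: overjumps_def)
qed

text \<open>
  For the vertex \<open>k\<close> whose edges are being drawn this is the normalising constant of the next choice.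
\<close>

lemma cum_weight_current:
  assumes "admissible m ws" "m > 0" "k \<ge> 2" "length ws \<le> m * (k - 1)"
  shows "cum_weight m u ws (k - 1) =
    2 * real m * u * (real k - 1) + real m * (real k - 2) + real (length ws)"
  using cum_weight_eq[OF assms(1-3), of u] overjumps_at_current_vertex[OF assms(4,3)] assms(4)
  by (simp add: min_absorb1)

lemma weight_nonneg: "u \<ge> 0 \<Longrightarrow> 0 \<le> weight m u ws j"
  by (simp add: weight_def)

text \<open>
  If \<open>u = 0\<close>, positivity comes from the first edge: it can only end at the vertex \<open>1\<close>.
\<close>

lemma cum_weight_pos:
  assumes "admissible m ws" "m > 0" "u \<ge> 0" "m \<le> length ws" "l \<ge> 1"
  shows "0 < cum_weight m u ws l"
proof -
  have "ws ! 0 = 1" "0 < length ws"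
    using assms by (force simp: admissible_def source_vertex_def)+
  then have "1 \<in> set ws" by (metis nth_mem)
  then have "count_list ws 1 > 0"
    by (metis count_list_0_iff neq0_conv)
  then have "0 < weight m u ws 1"
    using assms by (simp add: weight_def add_nonneg_pos)
  also have "weight m u ws 1 \<le> cum_weight m u ws l"
    unfolding cum_weight_def using assms
    by (intro member_le_sum) (auto simp: weight_nonneg)
  finally show ?thesis .
qed

section \<open>The sequential graph as the image of a random history\<close>

text \<open>
  Multiplying numerator and denominator by \<open>1 / (1 - \<alpha>)\<close> shows that the two mixture coefficients are in
  the proportion of the total uniform weight \<open>2 m u (k - 1)\<close> to the total degree \<open>Z\<close>.
\<close>

lemma alpha_tilde_simps:
  fixes \<alpha> :: real and i :: nat
  assumes "m > 0" "0 \<le> \<alpha>" "\<alpha> < 1" "u = \<alpha> / (1 - \<alpha>)" "k \<ge> 3"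
  defines "Z \<equiv> 2 * real m * (real k - 2) + (real i - 1)"
  assumes "i \<ge> 1"
  shows "alpha_tilde m \<alpha> k i = 2 * real m * u * (real k - 1) / (2 * real m * u * (real k - 1) + Z)"
    "1 - alpha_tilde m \<alpha> k i = Z / (2 * real m * u * (real k - 1) + Z)"
    "0 \<le> alpha_tilde m \<alpha> k i" "alpha_tilde m \<alpha> k i \<le> 1"
proof -
  have Z: "Z > 0"
    using assms unfolding Z_def by (intro add_pos_nonneg mult_pos_pos) auto
  have "2 * real m * u * (real k - 1) \<ge> 0"
    using assms by simp
  then have D: "2 * real m * u * (real k - 1) + Z > 0"
    using Z by linarith
  have eq: "2 * real m * (real k - 2) + 2 * real m * \<alpha> + (1 - \<alpha>) * (real i - 1) =
      (1 - \<alpha>) * (2 * real m * u * (real k - 1) + Z)"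
    using assms(3) unfolding Z_def assms(4) by (simp add: field_simps)
  have \<alpha>: "\<alpha> = (1 - \<alpha>) * u"
    using assms by simp
  have "alpha_tilde m \<alpha> k i =
     ((1 - \<alpha>) * (2 * real m * u * (real k - 1))) / ((1 - \<alpha>) * (2 * real m * u * (real k - 1) + Z))"
    unfolding alpha_tilde_def eq by (subst (1) \<alpha>) simp
  then show 1: "alpha_tilde m \<alpha> k i = 2 * real m * u * (real k - 1) / (2 * real m * u * (real k - 1) + Z)"
    using assms(3) by simp
  show "1 - alpha_tilde m \<alpha> k i = Z / (2 * real m * u * (real k - 1) + Z)"
    unfolding 1 using D by (simp add: field_simps)
  show "0 \<le> alpha_tilde m \<alpha> k i" "alpha_tilde m \<alpha> k i \<le> 1"
    unfolding 1 using D[THEN less_imp_le] D Z \<open>2 * real m * u * (real k - 1) \<ge> 0\<close> by (simp_all add: divide_le_eq not_less)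
qed

text \<open>
  In view of the two coefficients above, the factors \<open>k - 1\<close> and \<open>Z\<close> cancel, and the mixture is a choice
  with probability proportional to \<open>2 m u + deg' j\<close>.
\<close>

lemma pmf_endpoint:
  assumes m: "m > 0" and \<alpha>: "0 \<le> \<alpha>" "\<alpha> < 1" and u: "u = \<alpha> / (1 - \<alpha>)"
    and k: "k \<ge> 3" and val: "admissible m (H @ ws)" and len: "length H = m * (k - 2)" "length ws < m"
  shows "pmf (endpoint_pmf m \<alpha> k (history_graph m H) ws) j =
    (if j \<in> {1..k-1} then weight m u (H @ ws) j / cum_weight m u (H @ ws) (k - 1) else 0)"
proof -
  let ?G = "history_graph m H"
  let ?c = "2 * real m * u"
  define Z where "Z = 2 * real m * (real k - 2) + real (length ws)"
  define p where "p = alpha_tilde m \<alpha> k (Suc (length ws))"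
  define T where "T = ?c * (real k - 1) + Z"
  have valH: "admissible m H" using val by (rule admissible_prefix)
  have deg': "real (deg' ?G ws j) = weight m u (H @ ws) j - ?c" if "j \<in> {1..k-1}" for j
    using that k deg_history_graph[OF valH m k len(1), of j]
    by (auto simp: deg'_def weight_def)
  have "length (H @ ws) \<le> m * (k - 2) + m" using len by simp
  also have "m * (k - 2) + m = m * Suc (k - 2)" by simp
  also have "Suc (k - 2) = k - 1" using k by simp
  finally have "length (H @ ws) \<le> m * (k - 1)" .
  from cum_weight_current[OF val m _ this, of u] k
  have "cum_weight m u (H @ ws) (k - 1) =
      ?c * (real k - 1) + real m * (real k - 2) + real (length H + length ws)" by simp
  also have "real (length H + length ws) = real m * (real k - 2) + real (length ws)"
    unfolding len(1) using k by (simp add: of_nat_diff)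
  finally have cw: "cum_weight m u (H @ ws) (k - 1) = T"
    by (simp add: T_def Z_def algebra_simps)
  have "real (\<Sum>l\<in>{1..k-1}. deg' ?G ws l) = (\<Sum>l\<in>{1..k-1}. weight m u (H @ ws) l - ?c)"
    by (simp add: deg')
  also have "\<dots> = cum_weight m u (H @ ws) (k - 1) - ?c * (real k - 1)"
    using k by (simp add: sum_subtractf cum_weight_def of_nat_diff)
  also have "\<dots> = Z" unfolding cw T_def by simp
  finally have sum: "real (\<Sum>l\<in>{1..k-1}. deg' ?G ws l) = Z" .
  have Z: "Z > 0" unfolding Z_def using m k by (intro add_pos_nonneg) auto
  then have pos: "(\<Sum>l\<in>{1..k-1}. deg' ?G ws l) > 0"
    using sum by linarith
  have T: "T > 0" unfolding T_def using m k u \<alpha> Z by (intro add_nonneg_pos) auto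
  note at = alpha_tilde_simps[OF m \<alpha> u k, of "Suc (length ws)", simplified, folded p_def Z_def T_def]
  have "pmf (endpoint_pmf m \<alpha> k ?G ws) j =
      p * pmf (pmf_of_set {1..k-1}) j + (1 - p) * pmf (pref_pmf k ?G ws) j"
    unfolding endpoint_pmf_def p_def[symmetric] using at(3,4)
    by (simp add: pmf_bind)
  also have "\<dots> = (if j \<in> {1..k-1} then weight m u (H @ ws) j / T else 0)"
  proof (cases "j \<in> {1..k-1}")
    case True
    have ne: "{1..k-1} \<noteq> {}" using k by auto
    have "p * pmf (pmf_of_set {1..k-1}) j + (1 - p) * pmf (pref_pmf k ?G ws) j =
        p / (real k - 1) + (1 - p) * ((weight m u (H @ ws) j - ?c) / Z)"
      using True ne k by (simp only: pmf_pref_pmf[OF pos] pmf_of_set[OF ne] sum deg' finite_atLeastAtMost)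
        (simp add: of_nat_diff)
    also have "\<dots> = weight m u (H @ ws) j / T"
    proof -
      have "p / (real k - 1) = ?c / T" unfolding at(1) T_def using k by simp
      moreover have "(1 - p) * ((weight m u (H @ ws) j - ?c) / Z) = (weight m u (H @ ws) j - ?c) / T"
        unfolding at(2) T_def using Z by simp
      ultimately show ?thesis by (simp add: diff_divide_distrib)
    qed
    finally show ?thesis using True by simp
  next
    case False
    have ne: "{1..k-1} \<noteq> {}" using k by auto
    show ?thesis using False by (simp only: pmf_pref_pmf[OF pos] pmf_of_set[OF ne] finite_atLeastAtMost) simp
  qed
  finally show ?thesis unfolding cw .
qed

text \<open>
  The last \<open>t mod m\<close> entries of the history are the endpoints already chosen by the current vertex, the
  entries before them determine the graph on the older vertices. The edges of the vertex \<open>2\<close> are treated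
  separately: there the degrees are still \<open>0\<close> and \<^const>\<open>pref_pmf\<close> is meaningless.
\<close>

definition slot_pmf :: "nat \<Rightarrow> real \<Rightarrow> nat \<Rightarrow> nat list \<Rightarrow> nat pmf" where
  "slot_pmf m \<alpha> t ws =
    (if t < m then return_pmf 1
     else endpoint_pmf m \<alpha> (source_vertex m t) (history_graph m (take (m * (t div m)) ws))
            (drop (m * (t div m)) ws))"

primrec history_pmf :: "nat \<Rightarrow> real \<Rightarrow> nat \<Rightarrow> nat list pmf" where
  "history_pmf m \<alpha> 0 = return_pmf []"
| "history_pmf m \<alpha> (Suc t) =
     bind_pmf (history_pmf m \<alpha> t) (\<lambda>ws. map_pmf (\<lambda>w. ws @ [w]) (slot_pmf m \<alpha> t ws))"

declare history_pmf.simps(2) [simp del]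

lemma pmf_slot:
  assumes m: "m > 0" and \<alpha>: "0 \<le> \<alpha>" "\<alpha> < 1" and u: "u = \<alpha> / (1 - \<alpha>)"
    and val: "admissible m ws" and len: "length ws = t" "m \<le> t"
  shows "pmf (slot_pmf m \<alpha> t ws) w =
    (if w \<in> {1..source_vertex m t - 1} then weight m u ws w / cum_weight m u ws (source_vertex m t - 1) else 0)"
proof -
  let ?H = "take (m * (t div m)) ws" and ?ws = "drop (m * (t div m)) ws"
  have "1 \<le> t div m" using len m by (metis div_greater_zero_iff One_nat_def Suc_le_eq)
  then have k: "source_vertex m t \<ge> 3" by (simp add: source_vertex_def)
  have "m * (t div m) \<le> t" by simp
  then have "length ?H = m * (source_vertex m t - 2)" "length ?ws < m"
    using m len by (simp_all add: source_vertex_def minus_mult_div_eq_mod)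
  from pmf_endpoint[OF m \<alpha> u k _ this] val show ?thesis
    using len by (simp add: slot_pmf_def)
qed

lemma set_slot_pmf:
  assumes m: "m > 0" and \<alpha>: "0 \<le> \<alpha>" "\<alpha> < 1"
    and val: "admissible m ws" and len: "length ws = t" and w: "w \<in> set_pmf (slot_pmf m \<alpha> t ws)"
  shows "1 \<le> w \<and> w < source_vertex m t"
proof (cases "t < m")
  case True
  then show ?thesis using w by (simp add: slot_pmf_def source_vertex_def)
next
  case False
  then show ?thesis
    using w pmf_slot[OF m \<alpha> refl val len, of w] by (auto simp: set_pmf_eq source_vertex_def split: if_splits)
qed

lemma history_support:
  assumes m: "m > 0" and \<alpha>: "0 \<le> \<alpha>" "\<alpha> < 1" and "ws \<in> set_pmf (history_pmf m \<alpha> t)"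
  shows "length ws = t \<and> admissible m ws"
  using assms(4)
proof (induction t arbitrary: ws)
  case 0
  then show ?case by simp
next
  case (Suc t)
  then obtain ws' w where *: "ws' \<in> set_pmf (history_pmf m \<alpha> t)" "w \<in> set_pmf (slot_pmf m \<alpha> t ws')"
      "ws = ws' @ [w]"
    by (auto simp: history_pmf.simps(2))
  with Suc.IH[OF *(1)] set_slot_pmf[OF m \<alpha> _ _ *(2)] show ?case
    by (auto simp: admissible_snoc)
qed

lemma pmf_history_snoc:
  "pmf (history_pmf m \<alpha> (Suc t)) (ws @ [w]) = pmf (history_pmf m \<alpha> t) ws * pmf (slot_pmf m \<alpha> t ws) w"
proof -
  have "pmf (map_pmf (\<lambda>w. ws' @ [w]) p) (ws @ [w]) = (if ws' = ws then pmf p w else 0)" for ws' p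
    by (cases "ws' = ws") (auto simp: pmf_eq_0_set_pmf intro!: pmf_map_inj' simp: inj_def)
  then have "pmf (history_pmf m \<alpha> (Suc t)) (ws @ [w]) =
     (\<integral>ws'. (if ws' = ws then pmf (slot_pmf m \<alpha> t ws') w else 0) \<partial>history_pmf m \<alpha> t)"
    by (simp add: history_pmf.simps(2) pmf_bind)
  also have "\<dots> = pmf (history_pmf m \<alpha> t) ws * pmf (slot_pmf m \<alpha> t ws) w"
    by (subst integral_measure_pmf_real[of "{ws}"]) (auto split: if_splits)
  finally show ?thesis .
qed

lemma endpoints_length: "ws \<in> set_pmf (endpoints_pmf m \<alpha> k G i) \<Longrightarrow> length ws = i"
  by (induction i arbitrary: ws) auto

text \<open>
  A block of \<open>m\<close> consecutive slots is one step of the sequential construction, with \<open>d + 2\<close> as the new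
  vertex.
\<close>

lemma history_append_endpoints:
  assumes m: "m > 0" and \<alpha>: "0 \<le> \<alpha>" "\<alpha> < 1" and d: "d \<ge> 1" and i: "i \<le> m"
  shows "history_pmf m \<alpha> (m * d + i) = bind_pmf (history_pmf m \<alpha> (m * d)) (\<lambda>H.
    map_pmf (\<lambda>ws. H @ ws) (endpoints_pmf m \<alpha> (d + 2) (history_graph m H) i))"
  using i
proof (induction i)
  case 0
  then show ?case by (simp add: bind_return_pmf')
next
  case (Suc i)
  have *: "(m * d + i) div m = d" "\<not> m * d + i < m" using Suc.prems m mult_le_mono2[OF d, of m] by (simp, linarith)
  have "history_pmf m \<alpha> (m * d + Suc i) =
      bind_pmf (bind_pmf (history_pmf m \<alpha> (m * d)) (\<lambda>H.
        map_pmf (\<lambda>ws. H @ ws) (endpoints_pmf m \<alpha> (d + 2) (history_graph m H) i)))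
          (\<lambda>ws. map_pmf (\<lambda>w. ws @ [w]) (slot_pmf m \<alpha> (m * d + i) ws))"
    using Suc by (simp add: history_pmf.simps(2))
  also have "\<dots> = bind_pmf (history_pmf m \<alpha> (m * d)) (\<lambda>H.
    map_pmf (\<lambda>ws. H @ ws) (endpoints_pmf m \<alpha> (d + 2) (history_graph m H) (Suc i)))"
    unfolding bind_assoc_pmf
  proof (intro bind_pmf_cong refl, goal_cases)
    case (1 H)
    then have "length H = m * d" using history_support[OF m \<alpha>] by blast
    then show ?case
      using *
      by (auto simp: map_bind_pmf bind_map_pmf slot_pmf_def source_vertex_def map_pmf_comp add.commute endpoints_length
          intro!: bind_pmf_cong)
  qed
  finally show ?case .
qed

lemma history_first_block: "i \<le> m \<Longrightarrow> history_pmf m \<alpha> i = return_pmf (replicate i 1)"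
  by (induction i) (auto simp: history_pmf.simps(2) slot_pmf_def bind_return_pmf replicate_append_same)

lemma seq_pa_graph_eq_history:
  assumes m: "m > 0" and \<alpha>: "0 \<le> \<alpha>" "\<alpha> < 1"
  shows "seq_pa_graph m \<alpha> n = map_pmf (history_graph m) (history_pmf m \<alpha> (m * (n - 1)))"
proof -
  have "seq_pa_graph m \<alpha> (Suc (Suc d)) = map_pmf (history_graph m) (history_pmf m \<alpha> (m * Suc d))" for d
  proof (induction d)
    case 0
    have "map (\<lambda>s. {replicate m 1 ! s, source_vertex m s}) [0..<m] = replicate m {1, 2}"
      by (intro nth_equalityI) (auto simp: source_vertex_def)
    then have "history_graph m (replicate m 1) = replicate_mset m {1, 2}"
      by (simp only: history_graph_def length_replicate mset_replicate)
    then show ?case by (simp add: history_first_block)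
  next
    case (Suc d)
    let ?h = "history_pmf m \<alpha> (m * Suc d)" and ?n = "Suc (Suc (Suc d))"
    have eq: "m * Suc (Suc d) = m * Suc d + m" by simp
    have "map_pmf (history_graph m) (history_pmf m \<alpha> (m * Suc (Suc d))) =
      bind_pmf ?h (\<lambda>H. map_pmf (\<lambda>ws. history_graph m (H @ ws))
        (endpoints_pmf m \<alpha> (Suc d + 2) (history_graph m H) m))"
      unfolding eq by (subst history_append_endpoints[OF m \<alpha>]) (auto simp: map_bind_pmf map_pmf_comp)
    also have "\<dots> = bind_pmf ?h (\<lambda>H. map_pmf (\<lambda>ws. history_graph m H + mset (map (\<lambda>w. {w, ?n}) ws))
        (endpoints_pmf m \<alpha> ?n (history_graph m H) m))"
    proof (intro bind_pmf_cong refl, goal_cases)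
      case (1 H)
      then have "length H = m * Suc d" using history_support[OF m \<alpha>] by blast
      show ?case
      proof (subst numeral_2_eq_2, unfold add_Suc_right add_0_right, intro map_pmf_cong refl)
        fix ws assume "ws \<in> set_pmf (endpoints_pmf m \<alpha> ?n (history_graph m H) m)"
        then have "length ws = m" by (rule endpoints_length)
        from history_graph_append_block[OF \<open>length H = m * Suc d\<close> this]
        show "history_graph m (H @ ws) = history_graph m H + mset (map (\<lambda>w. {w, ?n}) ws)" by simp
      qed
    qed
    also have "\<dots> = seq_pa_graph m \<alpha> ?n"
      by (simp add: Suc.IH bind_map_pmf del: mult_Suc_right)
    finally show ?case ..
  qed
  from this[of "n - 2"] show ?thesis
    by (cases "n \<ge> 2") (auto simp: numeral_2_eq_2 Suc_diff_Suc not_le less_Suc_eq history_graph_def)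
qed

section \<open>The probability of a history as a product of Beta ratios\<close>

text \<open>
  The expectation of \<open>\<Prod>j. \<psi>\<^sub>j ^ A\<^sub>j * (1 - \<psi>\<^sub>j) ^ B\<^sub>j\<close>, where \<open>A\<^sub>j = count_list ws j\<close> and
  \<open>B\<^sub>j = overjumps m ws j\<close>.
\<close>

definition moment :: "nat \<Rightarrow> real \<Rightarrow> nat \<Rightarrow> nat list \<Rightarrow> real" where
  "moment m u n ws = (\<Prod>j\<in>{2..n}.
     Beta (real m + 2 * real m * u + real (count_list ws j))
       ((2 * real j - 3) * real m + 2 * real m * u * (real j - 1) + real (overjumps m ws j))
     / Beta (real m + 2 * real m * u) ((2 * real j - 3) * real m + 2 * real m * u * (real j - 1)))"

lemma prod_telescope_weights:
  fixes W :: "nat \<Rightarrow> real"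
  assumes "\<And>j. j \<ge> 1 \<Longrightarrow> W j > 0" "1 \<le> w" "w \<le> N"
  shows "(\<Prod>j\<in>{1..N}. if j = w then c / W j else if w < j then W (j - 1) / W j else 1) = c / W N"
  using assms(3)
proof (induction N rule: dec_induct)
  case base
  have "(\<Prod>j\<in>{1..w}. if j = w then c / W j else if w < j then W (j - 1) / W j else 1) =
      (\<Prod>j\<in>{1..w}. if j = w then c / W j else 1)"
    by (intro prod.cong) auto
  then show ?case using assms(2) by simp
next
  case (step N)
  then show ?case using assms(1)[of N] assms(2)
    by (simp add: prod.nat_ivl_Suc')
qed

text \<open>
  Appending \<open>w\<close> raises \<open>A\<^sub>w\<close> by \<open>1\<close>, and it raises \<open>B\<^sub>j\<close> by \<open>1\<close> for \<open>w < j < k\<close>. With \<open>W\<^sub>j\<close> for the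
  cumulative weights, the functional equation of the Beta function turns this into the factors
  \<open>weight w / W\<^sub>w\<close> and \<open>W\<^bsub>j-1\<^esub> / W\<^sub>j\<close>, whose product telescopes.
\<close>

lemma moment_snoc:
  assumes m: "m > 0" and u: "u \<ge> 0" and val: "admissible m ws" and w: "1 \<le> w" "w < source_vertex m (length ws)"
    and len: "m \<le> length ws" "length ws < m * (n - 1)"
  shows "moment m u n (ws @ [w]) =
    moment m u n ws * (weight m u ws w / cum_weight m u ws (source_vertex m (length ws) - 1))"
proof -
  define k where "k = source_vertex m (length ws)"
  define W where "W = cum_weight m u ws"
  define r where "r = (\<lambda>j. if j = w then weight m u ws w / W j else if w < j then W (j - 1) / W j else 1)"
  let ?A = "\<lambda>ws j. real m + 2 * real m * u + real (count_list ws j)"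
  let ?B = "\<lambda>ws j. (2 * real j - 3) * real m + 2 * real m * u * (real j - 1) + real (overjumps m ws j)"
  have Wpos: "W l > 0" if "l \<ge> 1" for l
    unfolding W_def using cum_weight_pos[OF val m u len(1) that] .
  have "length ws div m < n - 1"
    using len(2) by (simp add: less_mult_imp_div_less mult.commute)
  then have k: "2 \<le> k" "k \<le> n" by (auto simp: k_def source_vertex_def)
  have Apos: "?A ws' j > 0" for j ws' using m u by (intro add_pos_nonneg) auto
  have Bpos: "?B ws' j > 0" if "j \<ge> 2" for j ws'
    using m u that by (intro add_pos_nonneg mult_pos_pos) auto
  have factor: "Beta (?A (ws @ [w]) j) (?B (ws @ [w]) j) = Beta (?A ws j) (?B ws j) * (if j < k then r j else 1)"
    if j: "j \<ge> 2" for j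
  proof (cases "j < k")
    case True
    have "m * (j - 1) \<le> m * (length ws div m)"
      using True j by (intro mult_left_mono) (auto simp: k_def source_vertex_def)
    also have "\<dots> \<le> length ws" by simp
    finally have "m * (j - 1) \<le> length ws" .
    from cum_weight_older[OF val m j this, of u] have B: "?B ws j = W (j - 1)"
      by (simp add: W_def)
    have A: "?A ws j = weight m u ws j" using j by (simp add: weight_def)
    have "W j = W (j - 1) + weight m u ws j"
      using j unfolding W_def cum_weight_def by (cases j) auto
    then have AB: "?A ws j + ?B ws j = W j" unfolding A B by simp
    show ?thesis
    \<comment> \<open>If \<open>j = w\<close> the first parameter grows, if \<open>w < j\<close> the second one, and otherwise neither.\<close>
    proof (cases "j = w")
      case True
      then show ?thesis
        using Beta_step_left[OF Apos Bpos[OF j], of ws j ws] AB A \<open>j < k\<close>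
        by (simp add: r_def overjumps_snoc ac_simps)
    next
      case False
      show ?thesis
      proof (cases "w < j")
        case True
        then show ?thesis
          using Beta_step_right[OF Apos Bpos[OF j], of ws j ws] AB B \<open>j < k\<close> False
          by (simp add: r_def overjumps_snoc k_def ac_simps)
      qed (use False in \<open>simp add: r_def overjumps_snoc\<close>)
    qed
  next
    case False
    then show ?thesis
      using w by (auto simp: overjumps_snoc k_def)
  qed
  have "moment m u n (ws @ [w]) = moment m u n ws * (\<Prod>j\<in>{2..n}. if j < k then r j else 1)"
    unfolding moment_def prod.distrib[symmetric]
    by (intro prod.cong refl) (simp only: factor atLeastAtMost_iff, simp)
  also have "(\<Prod>j\<in>{2..n}. if j < k then r j else 1) = (\<Prod>j\<in>{2..k-1}. r j)"
    using k by (intro prod.mono_neutral_cong_right) auto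
  \<comment> \<open>The telescoping product may start at \<open>1\<close>, since \<open>W\<^sub>1\<close> is the weight of the vertex \<open>1\<close>.\<close>
  also have "\<dots> = (\<Prod>j\<in>{1..k-1}. r j)"
  proof -
    have "r 1 = 1"
    proof (cases "w = 1")
      case True
      then show ?thesis using Wpos[of 1] by (simp add: r_def W_def cum_weight_def)
    qed (use w in \<open>simp add: r_def\<close>)
    moreover have "{1..k-1} = insert 1 {2..k-1}" using k by auto
    ultimately show ?thesis by simp
  qed
  also have "\<dots> = weight m u ws w / W (k - 1)"
    unfolding r_def using w k Wpos by (intro prod_telescope_weights) (auto simp: k_def)
  finally show ?thesis unfolding k_def W_def .
qed

text \<open>
  Both sides are multiplied by the same factor when the history grows by one slot. For the first \<open>m\<close>
  slots this factor is \<open>1\<close>: they all end at the vertex \<open>1\<close> and pass over no vertex.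
\<close>

lemma pmf_history:
  assumes m: "m > 0" and \<alpha>: "0 \<le> \<alpha>" "\<alpha> < 1" and u: "u = \<alpha> / (1 - \<alpha>)"
    and val: "admissible m ws" and len: "length ws \<le> m * (n - 1)"
  shows "pmf (history_pmf m \<alpha> (length ws)) ws = moment m u n ws"
  using val len
proof (induction ws rule: rev_induct)
  case Nil
  have "u \<ge> 0" using \<alpha> u by simp
  then have "Beta (real m + 2 * real m * u) ((2 * real j - 3) * real m + 2 * real m * u * (real j - 1)) > 0"
    if "j \<ge> 2" for j :: nat
    using m that by (intro Beta_pos add_pos_nonneg mult_pos_pos) auto
  then show ?case by (auto simp: moment_def intro!: prod.neutral[symmetric] simp: less_imp_neq[symmetric])
next
  case (snoc w ws)
  have u0: "u \<ge> 0" using \<alpha> u by simp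
  from snoc.prems have v: "admissible m ws" "1 \<le> w" "w < source_vertex m (length ws)" and l: "length ws < m * (n - 1)"
    by (auto simp: admissible_snoc)
  have IH: "pmf (history_pmf m \<alpha> (length ws)) ws = moment m u n ws"
    using snoc.IH v l by simp
  show ?case
  proof (cases "length ws < m")
    case True
    then have "source_vertex m (length ws) = 2" by (simp add: source_vertex_def)
    with v have "w = 1" by simp
    have "moment m u n (ws @ [w]) = moment m u n ws"
      unfolding moment_def using \<open>w = 1\<close> \<open>source_vertex m (length ws) = 2\<close>
      by (intro prod.cong) (auto simp: overjumps_snoc)
    then show ?thesis
      using IH True \<open>w = 1\<close> by (simp add: pmf_history_snoc slot_pmf_def)
  next
    case False
    then have lm: "m \<le> length ws" by simp
    have "w \<in> {1..source_vertex m (length ws) - 1}" using v by auto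
    then show ?thesis
      using IH pmf_slot[OF m \<alpha> u v(1) refl lm] moment_snoc[OF m u0 v(1-3) lm l]
      by (simp add: pmf_history_snoc)
  qed
qed

section \<open>The urn intervals\<close>

text \<open>
  The almost sure properties of \<open>\<psi>\<close> that make the urn intervals a partition of \<open>[0, 1)\<close> into consecutive
  nonempty intervals.
\<close>

definition generic :: "nat \<Rightarrow> (nat \<Rightarrow> real) \<Rightarrow> bool" where
  "generic n p \<longleftrightarrow> p 1 = 1 \<and> (\<forall>j\<in>{2..n}. 0 < p j \<and> p j < 1)"

lemma urn_S_0 [simp]: "urn_S n p 0 = 0"
  by (simp add: urn_S_def)

lemma urn_S_Suc: "urn_S n p (Suc k) = urn_S n p k + urn_phi n p (Suc k)"
  by (simp add: urn_S_def)

text \<open>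
  The recursion \<open>S\<^sub>k = S\<^bsub>k+1\<^esub> - \<phi>\<^bsub>k+1\<^esub>\<close> amounts to multiplication by \<open>1 - \<psi>\<^bsub>k+1\<^esub>\<close>. The condition \<open>\<psi>\<^sub>1 = 1\<close>
  makes the identity hold for \<open>k = 1\<close>.
\<close>

lemma urn_S_eq_prod:
  assumes "p 1 = 1" "1 \<le> k" "k \<le> n"
  shows "urn_S n p k = (\<Prod>i\<in>{k+1..n}. 1 - p i)"
  using assms(2,3)
proof (induction k rule: dec_induct)
  case base
  then show ?case using assms(1) by (simp add: urn_S_def urn_phi_def)
next
  case (step k)
  have "{k+1..n} = insert (Suc k) {Suc k + 1..n}" using step by auto
  then have "(\<Prod>i\<in>{k+1..n}. 1 - p i) = (1 - p (Suc k)) * (\<Prod>i\<in>{Suc k + 1..n}. 1 - p i)"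
    by simp
  with step show ?case by (simp add: urn_S_Suc urn_phi_def algebra_simps)
qed

lemma urn_phi_nonneg:
  assumes "generic n p" "1 \<le> j" "j \<le> n" shows "0 \<le> urn_phi n p j"
proof -
  have "0 \<le> p j" using assms by (cases "j = 1") (auto simp: generic_def less_imp_le)
  then show ?thesis
    using assms unfolding urn_phi_def
    by (intro mult_nonneg_nonneg prod_nonneg) (auto simp: generic_def less_imp_le)
qed

lemma urn_S_mono:
  assumes "generic n p" "j \<le> k" "k \<le> n" shows "urn_S n p j \<le> urn_S n p k"
  using assms(2,3)
proof (induction k rule: dec_induct)
  case (step k)
  then show ?case using urn_phi_nonneg[OF assms(1), of "Suc k"] by (simp add: urn_S_Suc)
qed simp

lemma urn_S_pos:
  assumes "generic n p" "1 \<le> k" "k \<le> n" shows "0 < urn_S n p k"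
  using assms by (subst urn_S_eq_prod) (auto simp: generic_def intro!: prod_pos)

lemma urn_I_unique:
  assumes g: "generic n p" and jk: "1 \<le> j" "j \<le> n" "1 \<le> k" "k \<le> n"
    and x: "x \<in> urn_I n p j" "x \<in> urn_I n p k"
  shows "j = k"
proof -
  have "\<not> a < b" if "1 \<le> a" "b \<le> n" "x \<in> urn_I n p a" "x \<in> urn_I n p b" for a b
  proof
    assume "a < b"
    then have "urn_S n p a \<le> urn_S n p (b - 1)" using that by (intro urn_S_mono[OF g]) auto
    with that show False by (auto simp: urn_I_def)
  qed
  from this[of j k] this[of k j] show ?thesis using jk x by auto
qed

text \<open>
  The factors \<open>1 - \<psi>\<^sub>i\<close> with \<open>i \<ge> k\<close> cancel. This is why the law of the urn graph on \<open>{1..k}\<close> does not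
  depend on \<open>n\<close>.
\<close>

lemma urn_phi_ratio:
  assumes g: "generic n p" and "1 \<le> j" "j < k" "k \<le> n"
  shows "urn_phi n p j / urn_S n p (k - 1) = p j * (\<Prod>i\<in>{j+1..k-1}. 1 - p i)"
proof -
  have "{j+1..n} = {j+1..k-1} \<union> {k-1+1..n}" "{j+1..k-1} \<inter> {k-1+1..n} = {}" using assms by auto
  then have "(\<Prod>i\<in>{j+1..n}. 1 - p i) = (\<Prod>i\<in>{j+1..k-1}. 1 - p i) * (\<Prod>i\<in>{k-1+1..n}. 1 - p i)"
    by (simp add: prod.union_disjoint)
  moreover have "urn_S n p (k - 1) = (\<Prod>i\<in>{k-1+1..n}. 1 - p i)"
    using assms by (intro urn_S_eq_prod) (auto simp: generic_def)
  ultimately have "urn_phi n p j = p j * (\<Prod>i\<in>{j+1..k-1}. 1 - p i) * urn_S n p (k - 1)"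
    by (simp add: urn_phi_def)
  moreover have "urn_S n p (k - 1) > 0" using assms by (intro urn_S_pos[OF g]) auto
  ultimately show ?thesis by simp
qed

section \<open>The urn graph on the event of a history\<close>

text \<open>
  The index \<open>(k, i)\<close> of the mark \<open>U\<^bsub>k,i\<^esub>\<close> that decides the slot.
\<close>

definition slot :: "nat \<Rightarrow> nat \<Rightarrow> nat \<times> nat" where
  "slot m s = (source_vertex m s, Suc (s mod m))"

lemma inj_slot: "inj (slot m)"
proof (rule injI)
  fix s t assume "slot m s = slot m t"
  then have "s div m = t div m" "s mod m = t mod m" by (auto simp: slot_def source_vertex_def)
  then have "s div m * m + s mod m = t div m * m + t mod m" by (simp only:)
  then show "s = t" by (simp only: div_mult_mod_eq)
qed

text \<open>
  The marks \<open>U\<^bsub>1,i\<^esub>\<close> of the vertex \<open>1\<close> correspond to no slot.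
\<close>

lemma slot_image: "m > 0 \<Longrightarrow> slot m ` {..<m * (n - 1)} = {2..n} \<times> {1..m}"
proof (intro equalityI subsetI)
  fix x assume "m > 0" "x \<in> {2..n} \<times> {1..m}"
  then obtain k i where x: "x = (k, i)" "2 \<le> k" "k \<le> n" "1 \<le> i" "i \<le> m" by auto
  define s where "s = m * (k - 2) + (i - 1)"
  have "i - 1 < m" using x by auto
  then have "s div m = k - 2" "s mod m = i - 1" unfolding s_def by (simp_all del: One_nat_def)
  then have "x = slot m s" using x by (simp add: slot_def source_vertex_def)
  moreover have "s < m * (n - 1)"
  proof -
    have "s < m * Suc (k - 2)" using x by (simp add: s_def)
    also have "\<dots> \<le> m * (n - 1)" using x by (intro mult_left_mono) auto
    finally show ?thesis .
  qed
  ultimately show "x \<in> slot m ` {..<m * (n - 1)}" by blast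
next
  fix x assume m: "m > 0" and "x \<in> slot m ` {..<m * (n - 1)}"
  then obtain s where s: "s < m * (n - 1)" "x = slot m s" by blast
  have "2 \<le> source_vertex m s" "s mod m < m" using m by (simp_all add: source_vertex_def)
  then show "x \<in> {2..n} \<times> {1..m}" using source_vertex_le[OF s(1)] s(2) by (simp add: slot_def)
qed

definition hits :: "nat \<Rightarrow> nat \<Rightarrow> nat list \<Rightarrow> (nat \<Rightarrow> real) \<Rightarrow> (nat \<times> nat \<Rightarrow> real) \<Rightarrow> bool" where
  "hits m n ws p y \<longleftrightarrow> (\<forall>s<length ws. y (slot m s) \<in> urn_I n p (ws ! s))"

lemma hits_unique:
  assumes g: "generic n p" and val: "admissible m ws" "admissible m ws'"
    and len: "length ws = m * (n - 1)" "length ws' = m * (n - 1)"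
    and hits: "hits m n ws p y" "hits m n ws' p y"
  shows "ws = ws'"
proof (rule nth_equalityI)
  fix s assume s: "s < length ws"
  then have "source_vertex m s \<le> n" using len by (auto intro: source_vertex_le)
  then show "ws ! s = ws' ! s"
    using s val len hits by (intro urn_I_unique[OF g, of _ _ "y (slot m s)"]) (auto simp: admissible_def hits_def dest!: spec[of _ s])
qed (simp add: len)

text \<open>
  Once the mark of a slot lies in some \<open>I\<^sub>j\<close>, it lies in no other of these disjoint intervals, so each
  slot contributes exactly one edge.
\<close>

lemma urn_graph_eq_history_graph:
  assumes m: "m > 0" and g: "generic n p" and val: "admissible m ws" and len: "length ws = m * (n - 1)"
    and hits: "hits m n ws p y"
  shows "urn_graph m n p (\<lambda>k i. y (k, i)) = history_graph m ws"
proof -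
  let ?N = "m * (n - 1)"
  define f where "f = (\<lambda>s. (ws ! s, slot m s))"
  have w: "1 \<le> ws ! s" "ws ! s < source_vertex m s" "source_vertex m s \<le> n" "y (slot m s) \<in> urn_I n p (ws ! s)"
    if s: "s < ?N" for s
    using val len s source_vertex_le[OF s] hits by (auto simp: admissible_def hits_def)
  have "{(j, k, i). j \<in> {1..n} \<and> k \<in> {1..n} \<and> i \<in> {1..m} \<and> j < k \<and> y (k, i) \<in> urn_I n p j} =
      f ` {..<?N}"
  proof (intro equalityI subsetI)
    fix x assume "x \<in> {(j, k, i). j \<in> {1..n} \<and> k \<in> {1..n} \<and> i \<in> {1..m} \<and> j < k \<and> y (k, i) \<in> urn_I n p j}"
    then obtain j k i where x: "x = (j, k, i)" "1 \<le> j" "j \<le> n" "k \<le> n" "1 \<le> i" "i \<le> m" "j < k"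
      "y (k, i) \<in> urn_I n p j" by auto
    then have "(k, i) \<in> slot m ` {..<?N}" unfolding slot_image[OF m] by simp
    then obtain s where s: "s < ?N" "slot m s = (k, i)" by auto
    have "j = ws ! s"
      using x w[OF s(1)] s(2) by (intro urn_I_unique[OF g, of _ _ "y (k, i)"]) auto
    then show "x \<in> f ` {..<?N}" using s x by (auto simp: f_def intro!: image_eqI[of _ _ s])
  next
    fix x assume "x \<in> f ` {..<?N}"
    then obtain s where s: "s < ?N" "x = f s" by auto
    have "slot m s \<in> {2..n} \<times> {1..m}" using slot_image[OF m, of n] s by blast
    then show "x \<in> {(j, k, i). j \<in> {1..n} \<and> k \<in> {1..n} \<and> i \<in> {1..m} \<and> j < k \<and> y (k, i) \<in> urn_I n p j}"
      using w[OF s(1)] s by (auto simp: f_def slot_def)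
  qed
  moreover have "inj_on f {..<?N}"
    by (auto simp: f_def inj_on_def dest: injD[OF inj_slot])
  ultimately have "urn_graph m n p (\<lambda>k i. y (k, i)) =
      image_mset (\<lambda>(j, k, i). {j, k}) (image_mset f (mset_set {..<?N}))"
    by (simp add: urn_graph_def image_mset_mset_set)
  also have "\<dots> = image_mset (\<lambda>s. {ws ! s, source_vertex m s}) (mset_set {..<?N})"
    by (simp add: multiset.map_comp comp_def f_def slot_def)
  also have "\<dots> = history_graph m ws"
    by (simp add: history_graph_def len atLeast0LessThan)
  finally show ?thesis .
qed

text \<open>
  The image of independent uniform variables \<open>v\<close> on \<open>[0, 1]\<close> under this map has the conditional law of
  the marks \<open>U\<close> given \<open>\<psi> = p\<close>.
\<close>

definition scale_marks :: "nat \<Rightarrow> nat \<Rightarrow> (nat \<Rightarrow> real) \<Rightarrow> (nat \<times> nat \<Rightarrow> real) \<Rightarrow> nat \<times> nat \<Rightarrow> real" where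
  "scale_marks m n p v = (\<lambda>x\<in>{1..n}\<times>{1..m}. max 0 (urn_S n p (fst x - 1)) * v x)"

text \<open>
  Different slots are decided by different coordinates, so the event is a box in a product space. The
  side that belongs to the slot of an edge from \<open>k\<close> to \<open>w\<close> has length \<open>\<phi>\<^sub>w / S\<^bsub>k-1\<^esub>\<close>.
\<close>

lemma prob_hits:
  assumes m: "m > 0" and g: "generic n p" and val: "admissible m ws" and len: "length ws = m * (n - 1)"
  defines "R \<equiv> PiM ({1..n} \<times> {1..m}) (\<lambda>_. unif01)"
  shows "measure R {v \<in> space R. hits m n ws p (scale_marks m n p v)} =
    (\<Prod>s<length ws. p (ws ! s) * (\<Prod>i\<in>{ws ! s + 1..source_vertex m s - 1}. 1 - p i))"
proof -
  let ?J = "{1..n} \<times> {1..m}" and ?N = "m * (n - 1)"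
  interpret U: prob_space unif01 by (rule prob_space_unif01)
  interpret P: finite_product_prob_space "\<lambda>_. unif01" ?J
    by unfold_locales simp
  \<comment> \<open>By injectivity of \<open>slot m\<close> at most one \<open>s\<close> constrains the coordinate \<open>x\<close>, and none does if \<open>x\<close>
    belongs to the vertex \<open>1\<close>.\<close>
  define E where "E = (\<lambda>x. {y. \<forall>s<?N. slot m s = x \<longrightarrow>
    max 0 (urn_S n p (fst x - 1)) * y \<in> urn_I n p (ws ! s)})"
  have slotJ: "slot m s \<in> ?J" if "s < ?N" for s
  proof -
    have "slot m s \<in> {2..n} \<times> {1..m}"
      using that unfolding slot_image[OF m, symmetric] by blast
    then show ?thesis by auto
  qed
  have box: "{v \<in> space R. hits m n ws p (scale_marks m n p v)} = Pi\<^sub>E ?J E"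
  proof (rule set_eqI)
    fix v
    have "hits m n ws p (scale_marks m n p v) \<longleftrightarrow>
        (\<forall>s<?N. max 0 (urn_S n p (fst (slot m s) - 1)) * v (slot m s) \<in> urn_I n p (ws ! s))"
      unfolding hits_def scale_marks_def len using slotJ by (simp only: restrict_apply simp_thms cong: imp_cong) simp
    also have "\<dots> \<longleftrightarrow> (\<forall>x\<in>?J. v x \<in> E x)"
      unfolding E_def using slotJ by blast
    finally show "v \<in> {v \<in> space R. hits m n ws p (scale_marks m n p v)} \<longleftrightarrow> v \<in> Pi\<^sub>E ?J E"
      by (simp add: R_def space_PiM PiE_iff conj_commute)
  qed
  have E_slot: "E (slot m s) = {y. urn_S n p (source_vertex m s - 1) * y \<in> {urn_S n p (ws ! s - 1)..<urn_S n p (ws ! s)}}"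
    and S: "0 \<le> urn_S n p (ws ! s - 1)" "urn_S n p (ws ! s - 1) \<le> urn_S n p (ws ! s)"
      "urn_S n p (ws ! s) \<le> urn_S n p (source_vertex m s - 1)" "0 < urn_S n p (source_vertex m s - 1)"
    and w: "1 \<le> ws ! s" "ws ! s < source_vertex m s" "source_vertex m s \<le> n"
    if s: "s < ?N" for s
  proof -
    show w: "1 \<le> ws ! s" "ws ! s < source_vertex m s" "source_vertex m s \<le> n"
      using val len s source_vertex_le[OF s] by (auto simp: admissible_def)
    show "0 < urn_S n p (source_vertex m s - 1)" using w by (intro urn_S_pos[OF g]) auto
    then show "E (slot m s) = {y. urn_S n p (source_vertex m s - 1) * y \<in> {urn_S n p (ws ! s - 1)..<urn_S n p (ws ! s)}}"
      using s by (auto simp: E_def urn_I_def slot_def[of m s] max_def dest: injD[OF inj_slot])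
        (auto simp: slot_def[symmetric] dest: injD[OF inj_slot])
    show "urn_S n p (ws ! s - 1) \<le> urn_S n p (ws ! s)" "urn_S n p (ws ! s) \<le> urn_S n p (source_vertex m s - 1)"
      using w by (auto intro!: urn_S_mono[OF g])
    show "0 \<le> urn_S n p (ws ! s - 1)"
      using urn_S_mono[OF g, of 0 "ws ! s - 1"] w by simp
  qed
  have E_other: "E x = UNIV" if "x \<notin> slot m ` {..<?N}" for x
    using that by (auto simp: E_def)
  have E_sets: "E x \<in> sets unif01" for x
  proof (cases "x \<in> slot m ` {..<?N}")
    case True
    then obtain s where "s < ?N" "x = slot m s" by auto
    then show ?thesis using E_slot by simp
  qed (simp add: E_other)
  have "measure R {v \<in> space R. hits m n ws p (scale_marks m n p v)} = (\<Prod>x\<in>?J. measure unif01 (E x))"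
    unfolding box unfolding R_def using E_sets
    by (intro P.finite_measure_PiM_emb) auto
  also have "\<dots> = (\<Prod>x\<in>slot m ` {..<?N}. measure unif01 (E x))"
  proof (intro prod.mono_neutral_right ballI)
    show "slot m ` {..<?N} \<subseteq> ?J" using slotJ by blast
    show "measure unif01 (E x) = 1" if "x \<in> ?J - slot m ` {..<?N}" for x
      using that U.prob_space by (simp add: E_other)
  qed simp
  also have "\<dots> = (\<Prod>s<?N. measure unif01 (E (slot m s)))"
    by (subst prod.reindex) (auto intro: inj_on_subset[OF inj_slot])
  also have "\<dots> = (\<Prod>s<?N. p (ws ! s) * (\<Prod>i\<in>{ws ! s + 1..source_vertex m s - 1}. 1 - p i))"
  proof (intro prod.cong refl)
    fix s assume "s \<in> {..<?N}"
    then have s: "s < ?N" by simp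
    have "urn_S n p (ws ! s) - urn_S n p (ws ! s - 1) = urn_phi n p (ws ! s)"
      using urn_S_Suc[of n p "ws ! s - 1"] w[OF s] by simp
    then show "measure unif01 (E (slot m s)) = p (ws ! s) * (\<Prod>i\<in>{ws ! s + 1..source_vertex m s - 1}. 1 - p i)"
      unfolding E_slot[OF s] using measure_unif01_scaled_interval[OF S[OF s]] urn_phi_ratio[OF g w[OF s]]
      by simp
  qed
  finally show ?thesis by (simp add: len)
qed

text \<open>
  Exchange the two products: the factor \<open>\<psi>\<^sub>j\<close> occurs once for every edge that ends at \<open>j\<close>, and the factor
  \<open>1 - \<psi>\<^sub>j\<close> once for every edge that passes over \<open>j\<close>. The vertex \<open>1\<close> drops out because \<open>\<psi>\<^sub>1 = 1\<close>.
\<close>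

lemma prod_over_history:
  fixes p :: "nat \<Rightarrow> real"
  assumes p: "p 1 = 1" and "admissible m ws" "length ws \<le> m * (n - 1)"
  shows "(\<Prod>s<length ws. p (ws ! s) * (\<Prod>i\<in>{ws ! s + 1..source_vertex m s - 1}. 1 - p i)) =
    (\<Prod>j\<in>{2..n}. p j ^ count_list ws j * (1 - p j) ^ overjumps m ws j)"
  using assms(2,3)
proof (induction ws rule: rev_induct)
  case Nil
  then show ?case by simp
next
  case (snoc w ws)
  define k where "k = source_vertex m (length ws)"
  from snoc.prems have v: "admissible m ws" "1 \<le> w" "w < k" and l: "length ws < m * (n - 1)"
    by (auto simp: admissible_snoc k_def)
  have k: "k \<le> n" unfolding k_def by (rule source_vertex_le[OF l])
  have "p w = (\<Prod>j\<in>{2..n}. if j = w then p j else 1)"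
    using v k p by (cases "w = 1") (auto simp: prod.delta)
  moreover have "(\<Prod>i\<in>{w+1..k-1}. 1 - p i) = (\<Prod>j\<in>{2..n}. if w < j \<and> j < k then 1 - p j else 1)"
    using v k by (intro prod.mono_neutral_cong_left) auto
  ultimately have step: "p w * (\<Prod>i\<in>{w+1..k-1}. 1 - p i) =
      (\<Prod>j\<in>{2..n}. (if j = w then p j else 1) * (if w < j \<and> j < k then 1 - p j else 1))"
    by (simp add: prod.distrib)
  have "(\<Prod>s<length (ws @ [w]). p ((ws @ [w]) ! s) * (\<Prod>i\<in>{(ws @ [w]) ! s + 1..source_vertex m s - 1}. 1 - p i)) =
      (\<Prod>s<length ws. p (ws ! s) * (\<Prod>i\<in>{ws ! s + 1..source_vertex m s - 1}. 1 - p i)) *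
      (p w * (\<Prod>i\<in>{w+1..k-1}. 1 - p i))"
    by (simp add: nth_append k_def)
  also have "\<dots> = (\<Prod>j\<in>{2..n}. p j ^ count_list ws j * (1 - p j) ^ overjumps m ws j) *
      (\<Prod>j\<in>{2..n}. (if j = w then p j else 1) * (if w < j \<and> j < k then 1 - p j else 1))"
    using snoc.IH[OF v(1)] l step by simp
  also have "\<dots> = (\<Prod>j\<in>{2..n}. p j ^ count_list (ws @ [w]) j * (1 - p j) ^ overjumps m (ws @ [w]) j)"
    unfolding prod.distrib[symmetric]
    by (intro prod.cong refl) (auto simp: overjumps_snoc k_def)
  finally show ?case .
qed

section \<open>Measurability\<close>

lemma urn_S_restrict: "k \<le> n \<Longrightarrow> urn_S n (\<lambda>j\<in>{1..n}. p j) k = urn_S n p k"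
  unfolding urn_S_def urn_phi_def
  by (intro sum.cong arg_cong2[where f = "(*)"] prod.cong) auto

text \<open>
  The hypothesis of the theorem is about the restrictions of \<open>\<psi>\<close> and \<open>U\<close> to the finite index sets.
\<close>

lemma urn_graph_restrict:
  "urn_graph m n (\<lambda>j\<in>{1..n}. p j) (\<lambda>k i. (\<lambda>(k, i)\<in>{1..n} \<times> {1..m}. y k i) (k, i)) = urn_graph m n p y"
proof -
  have "urn_I n (\<lambda>j\<in>{1..n}. p j) j = urn_I n p j" if "j \<in> {1..n}" for j
  proof -
    have "j \<le> n" "j - 1 \<le> n" using that by auto
    then show ?thesis by (simp only: urn_I_def urn_S_restrict)
  qed
  then show ?thesis
    unfolding urn_graph_def by (intro arg_cong2[where f = image_mset] arg_cong[where f = mset_set] refl) auto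
qed

lemma measurable_urn_S:
  assumes "k \<le> n"
  shows "(\<lambda>p. urn_S n p k) \<in> borel_measurable (PiM {1..n} (\<lambda>_. borel))"
  unfolding urn_S_def urn_phi_def using assms
  by (intro borel_measurable_sum borel_measurable_times borel_measurable_prod borel_measurable_diff
      borel_measurable_const measurable_component_singleton) auto

lemma measurable_scale_marks:
  "(\<lambda>(p, v). scale_marks m n p v) \<in> measurable
     (PiM {1..n} (\<lambda>_. borel) \<Otimes>\<^sub>M PiM ({1..n} \<times> {1..m}) (\<lambda>_. unif01)) (PiM ({1..n} \<times> {1..m}) (\<lambda>_. borel))"
  unfolding scale_marks_def split_def
proof (rule measurable_restrict)
  fix x assume x: "x \<in> {1..n} \<times> {1..m}"
  then have [measurable]: "(\<lambda>p. urn_S n p (fst x - 1)) \<in> borel_measurable (PiM {1..n} (\<lambda>_. borel))"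
    by (intro measurable_urn_S) auto
  have "(\<lambda>v. v x) \<in> measurable (PiM ({1..n} \<times> {1..m}) (\<lambda>_. unif01)) unif01"
    using x by (rule measurable_component_singleton)
  moreover have "measurable (PiM ({1..n} \<times> {1..m}) (\<lambda>_. unif01)) unif01 =
      borel_measurable (PiM ({1..n} \<times> {1..m}) (\<lambda>_. unif01))"
    by (intro measurable_cong_sets) simp_all
  ultimately have [measurable]: "(\<lambda>v. v x) \<in> borel_measurable (PiM ({1..n} \<times> {1..m}) (\<lambda>_. unif01))"
    by (simp only:)
  show "(\<lambda>z. max 0 (urn_S n (fst z) (fst x - 1)) * snd z x) \<in> borel_measurable
     (PiM {1..n} (\<lambda>_. borel) \<Otimes>\<^sub>M PiM ({1..n} \<times> {1..m}) (\<lambda>_. unif01))"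
    by measurable
qed

lemma marks_kernel_eq:
  "PiM ({1..n} \<times> {1..m}) (\<lambda>(k, i). uniform_0_to (urn_S n p (k - 1))) =
    distr (PiM ({1..n} \<times> {1..m}) (\<lambda>_. unif01)) (PiM ({1..n} \<times> {1..m}) (\<lambda>_. borel)) (scale_marks m n p)"
  using PiM_distr_finite[of "{1..n} \<times> {1..m}" "\<lambda>_. unif01" "\<lambda>x y. max 0 (urn_S n p (fst x - 1)) * y" "\<lambda>_. borel"]
    prob_space_unif01
  by (simp add: uniform_0_to_eq_scaled scale_marks_def[abs_def] split_def)

lemma measurable_hits:
  assumes val: "admissible m ws" and len: "length ws = m * (n - 1)" and m: "m > 0"
  shows "Measurable.pred (PiM {1..n} (\<lambda>_. borel) \<Otimes>\<^sub>M PiM ({1..n} \<times> {1..m}) (\<lambda>_. borel))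
    (\<lambda>z. hits m n ws (fst z) (snd z))"
proof -
  let ?N = "PiM {1..n} (\<lambda>_. borel :: real measure)"
  let ?L = "PiM ({1..n} \<times> {1..m}) (\<lambda>_. borel :: real measure)"
  have "Measurable.pred (?N \<Otimes>\<^sub>M ?L) (\<lambda>z. snd z (slot m s) \<in> urn_I n (fst z) (ws ! s))"
    if s: "s < length ws" for s
  proof -
    have w: "ws ! s < source_vertex m s" "source_vertex m s \<le> n"
      using s val source_vertex_le[of s m n] len by (auto simp: admissible_def)
    have [measurable]: "(\<lambda>p. urn_S n p (ws ! s)) \<in> borel_measurable ?N"
      "(\<lambda>p. urn_S n p (ws ! s - 1)) \<in> borel_measurable ?N"
      using measurable_urn_S[of "ws ! s" n] measurable_urn_S[of "ws ! s - 1" n] w by simp_all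
    have "slot m s \<in> {2..n} \<times> {1..m}"
      using s unfolding slot_image[OF m, symmetric] len by blast
    then have [measurable]: "(\<lambda>v. v (slot m s)) \<in> borel_measurable ?L"
      by (intro measurable_component_singleton) auto
    show ?thesis unfolding urn_I_def atLeastLessThan_iff by measurable
  qed
  then show ?thesis
    unfolding hits_def by (intro pred_intros_countable(1) pred_intros_imp') auto
qed

lemma measurable_generic:
  assumes "n \<ge> 1" shows "Measurable.pred (PiM {1..n} (\<lambda>_. borel)) (generic n)"
proof -
  have c [measurable]: "(\<lambda>p. p j) \<in> borel_measurable (PiM {1..n} (\<lambda>_. borel))" if "j \<in> {1..n}" for j
    using that by (rule measurable_component_singleton)
  have [measurable]: "(\<lambda>p. p 1) \<in> borel_measurable (PiM {1..n} (\<lambda>_. borel))" using assms by (intro c) auto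
  have "Measurable.pred (PiM {1..n} (\<lambda>_. borel)) (\<lambda>p. 0 < p j \<and> p j < (1::real))" if "j \<in> {2..n}" for j
  proof -
    have [measurable]: "(\<lambda>p. p j) \<in> borel_measurable (PiM {1..n} (\<lambda>_. borel))" using that by (intro c) auto
    show ?thesis by measurable
  qed
  then have "Measurable.pred (PiM {1..n} (\<lambda>_. borel)) (\<lambda>p. \<forall>j\<in>{2..n}. 0 < p j \<and> p j < (1::real))"
    by (intro pred_intros_finite) auto
  moreover have "Measurable.pred (PiM {1..n} (\<lambda>_. borel)) (\<lambda>p. p 1 = (1::real))"
    by measurable
  ultimately show ?thesis
    unfolding generic_def[abs_def] by (intro pred_intros_logic)
qed

text \<open>
  Multigraphs form an uncountable type, so measurability cannot be checked on singletons directly. But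
  the graph is a function of a random subset of a finite set of possible edges.
\<close>

lemma measurable_urn_graph:
  assumes "n \<ge> 1"
  shows "(\<lambda>z. urn_graph m n (fst z) (\<lambda>k i. snd z (k, i))) \<in> measurable
    (PiM {1..n} (\<lambda>_. borel) \<Otimes>\<^sub>M PiM ({1..n} \<times> {1..m}) (\<lambda>_. borel)) (count_space UNIV)"
proof -
  let ?P = "PiM {1..n} (\<lambda>_. borel :: real measure) \<Otimes>\<^sub>M PiM ({1..n} \<times> {1..m}) (\<lambda>_. borel :: real measure)"
  define F where "F = {(j, k, i). j \<in> {1..n} \<and> k \<in> {1..n} \<and> i \<in> {1..m} \<and> j < k}"
  define E where "E = (\<lambda>z :: (nat \<Rightarrow> real) \<times> (nat \<times> nat \<Rightarrow> real).
    {(j, k, i). j \<in> {1..n} \<and> k \<in> {1..n} \<and> i \<in> {1..m} \<and> j < k \<and> snd z (k, i) \<in> urn_I n (fst z) j})"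
  have "F \<subseteq> {1..n} \<times> {1..n} \<times> {1..m}" by (auto simp: F_def)
  then have finF: "finite F" by (rule finite_subset) simp
  have pred: "Measurable.pred ?P (\<lambda>z. x \<in> E z)" if "x \<in> F" for x
  proof -
    obtain j k i where "x = (j, k, i)" by (cases x)
    with that have x: "x = (j, k, i)" "1 \<le> j" "j \<le> n" "1 \<le> k" "k \<le> n" "1 \<le> i" "i \<le> m" "j < k"
      by (auto simp: F_def)
    have [measurable]: "(\<lambda>p. urn_S n p j) \<in> borel_measurable (PiM {1..n} (\<lambda>_. borel))"
      "(\<lambda>p. urn_S n p (j - 1)) \<in> borel_measurable (PiM {1..n} (\<lambda>_. borel))"
      using measurable_urn_S[of j n] measurable_urn_S[of "j - 1" n] x by simp_all
    have [measurable]: "(\<lambda>v. v (k, i)) \<in> borel_measurable (PiM ({1..n} \<times> {1..m}) (\<lambda>_. borel))"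
      using x by (intro measurable_component_singleton) auto
    have eq: "(\<lambda>z. x \<in> E z) = (\<lambda>z. urn_S n (fst z) (j - 1) \<le> snd z (k, i) \<and> snd z (k, i) < urn_S n (fst z) j)"
      using x by (simp add: E_def urn_I_def)
    show ?thesis unfolding eq by measurable
  qed
  have "E \<in> measurable ?P (count_space (Pow F))"
    unfolding measurable_count_space_eq2[OF finite_Pow_iff[THEN iffD2, OF finF]]
  proof (intro conjI ballI)
    show "E \<in> space ?P \<rightarrow> Pow F" by (auto simp: E_def F_def)
    fix A assume A: "A \<in> Pow F"
    have "E -` {A} \<inter> space ?P = {z \<in> space ?P. \<forall>x\<in>F. x \<in> E z \<longleftrightarrow> x \<in> A}"
      using A by (auto simp: E_def F_def set_eq_iff)
    also have "\<dots> \<in> sets ?P"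
      using pred finF by measurable
    finally show "E -` {A} \<inter> space ?P \<in> sets ?P" .
  qed
  moreover have "(\<lambda>A. image_mset (\<lambda>(j, k, i). {j, k}) (mset_set A)) \<in> measurable (count_space (Pow F)) (count_space UNIV)"
    by simp
  ultimately have "(\<lambda>z. image_mset (\<lambda>(j, k, i). {j, k}) (mset_set (E z))) \<in> measurable ?P (count_space UNIV)"
    by (rule measurable_compose)
  then show ?thesis by (simp add: urn_graph_def E_def)
qed

section \<open>The two graphs have the same distribution\<close>

theorem theorem2p1:
  fixes m n :: nat and \<alpha> u :: real
    and M :: "'a measure" and \<psi> :: "nat \<Rightarrow> 'a \<Rightarrow> real" and U :: "nat \<Rightarrow> nat \<Rightarrow> 'a \<Rightarrow> real"
  assumes m: "m \<ge> 2" and n: "n \<ge> 1" and \<alpha>: "0 \<le> \<alpha>" "\<alpha> < 1" and u: "u = \<alpha> / (1 - \<alpha>)"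
    and M: "prob_space M"
    and psi_1: "\<And>\<omega>. \<omega> \<in> space M \<Longrightarrow> \<psi> 1 \<omega> = 1"
    and psi_indep: "prob_space.indep_vars M (\<lambda>_. borel) \<psi> {2..n}"
    and psi_beta: "\<And>j. j \<in> {2..n} \<Longrightarrow>
      distributed M lborel (\<psi> j) (\<lambda>x. ennreal (beta_density
        (real m + 2 * real m * u)
        ((2 * real j - 3) * real m + 2 * real m * u * (real j - 1)) x))"
    and U_cond: "has_cond_distr M
      (Pi\<^sub>M {1..n} (\<lambda>_. borel)) (\<lambda>\<omega>. \<lambda>j\<in>{1..n}. \<psi> j \<omega>)
      (Pi\<^sub>M ({1..n} \<times> {1..m}) (\<lambda>_. borel)) (\<lambda>\<omega>. \<lambda>(k, i)\<in>{1..n} \<times> {1..m}. U k i \<omega>)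
      (\<lambda>p. Pi\<^sub>M ({1..n} \<times> {1..m}) (\<lambda>(k, i). uniform_0_to (urn_S n p (k - 1))))"
  shows "distr M (count_space UNIV) (\<lambda>\<omega>. urn_graph m n (\<lambda>j. \<psi> j \<omega>) (\<lambda>k i. U k i \<omega>)) =
    measure_pmf (seq_pa_graph m \<alpha> n)"
proof -
  interpret M: prob_space M by fact
  let ?N = "m * (n - 1)" and ?J = "{1..n} \<times> {1..m}"
  let ?P = "PiM {1..n} (\<lambda>_. borel :: real measure)" and ?L = "PiM ?J (\<lambda>_. borel :: real measure)"
  let ?R = "PiM ?J (\<lambda>_. unif01)"
  define X where "X = (\<lambda>\<omega>. \<lambda>j\<in>{1..n}. \<psi> j \<omega>)"
  define Y where "Y = (\<lambda>\<omega>. \<lambda>(k, i)\<in>?J. U k i \<omega>)"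
  have m0: "m > 0" using m by simp
  have u0: "u \<ge> 0" using \<alpha> u by simp
  interpret R: prob_space ?R by (intro prob_space_PiM prob_space_unif01)
  have X [measurable]: "X \<in> measurable M ?P" and Y [measurable]: "Y \<in> measurable M ?L"
    using U_cond by (simp_all add: has_cond_distr_def X_def Y_def)
  have XY: "(\<lambda>\<omega>. (X \<omega>, Y \<omega>)) \<in> measurable M (?P \<Otimes>\<^sub>M ?L)" by measurable
  define gph where "gph = (\<lambda>\<omega>. urn_graph m n (\<lambda>j. \<psi> j \<omega>) (\<lambda>k i. U k i \<omega>))"
  have gph_eq: "gph \<omega> = urn_graph m n (X \<omega>) (\<lambda>k i. Y \<omega> (k, i))" for \<omega>
    by (simp only: gph_def X_def Y_def urn_graph_restrict)
  have gph [measurable]: "gph \<in> measurable M (count_space UNIV)"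
    using measurable_compose[OF XY measurable_urn_graph[OF n, of m]] by (simp add: gph_eq[abs_def])

  have AE_generic: "AE \<omega> in M. generic n (X \<omega>)"
  proof -
    have "AE \<omega> in M. \<forall>j\<in>{2..n}. 0 < \<psi> j \<omega> \<and> \<psi> j \<omega> < 1"
      by (intro AE_finite_allI M.AE_beta_interior[OF psi_beta]) auto
    then show ?thesis
      using AE_space by eventually_elim (use n psi_1 in \<open>auto simp: generic_def X_def\<close>)
  qed

  \<comment> \<open>The event that the urn model produces the history \<open>ws\<close>. Restricting to generic \<open>\<psi>\<close> makes these
    events disjoint.\<close>
  define E where "E = (\<lambda>ws. {\<omega> \<in> space M. generic n (X \<omega>) \<and> hits m n ws (X \<omega>) (Y \<omega>)})"
  define W where "W = {ws. admissible m ws \<and> length ws = ?N}"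
  have E_sets: "E ws \<in> M.events" if "ws \<in> W" for ws
  proof -
    have [measurable]: "Measurable.pred M (\<lambda>\<omega>. generic n (X \<omega>))"
      using measurable_compose[OF X measurable_generic[OF n]] by simp
    have [measurable]: "Measurable.pred M (\<lambda>\<omega>. hits m n ws (X \<omega>) (Y \<omega>))"
      using measurable_compose[OF XY measurable_hits[of m ws n]] that m0 by (simp add: W_def)
    show ?thesis unfolding E_def by measurable
  qed
  have E_prob: "M.prob (E ws) = pmf (history_pmf m \<alpha> ?N) ws" if ws: "ws \<in> W" for ws
  proof -
    have val: "admissible m ws" and len: "length ws = ?N" using ws by (auto simp: W_def)
    define C where "C = {z \<in> space (?P \<Otimes>\<^sub>M ?L). hits m n ws (fst z) (snd z)}"
    have C: "C \<in> sets (?P \<Otimes>\<^sub>M ?L)"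
      unfolding C_def using measurable_hits[OF val len m0] by (simp add: pred_def)
    let ?b = "\<lambda>j :: nat. (2 * real j - 3) * real m + 2 * real m * u * (real j - 1)"
    have "emeasure M (E ws) = emeasure M {\<omega> \<in> space M. (X \<omega>, Y \<omega>) \<in> C}"
    proof (rule emeasure_eq_AE)
      show "AE \<omega> in M. \<omega> \<in> E ws \<longleftrightarrow> \<omega> \<in> {\<omega> \<in> space M. (X \<omega>, Y \<omega>) \<in> C}"
        using AE_generic AE_space
        by eventually_elim (use measurable_space[OF XY] in \<open>auto simp: E_def C_def\<close>)
      show "{\<omega> \<in> space M. (X \<omega>, Y \<omega>) \<in> C} \<in> sets M"
        using measurable_sets[OF XY C] by (simp add: vimage_def Int_def conj_commute)
    qed (rule E_sets[OF ws])
    also have "\<dots> = (\<integral>\<^sup>+\<omega>. emeasure ?R {v \<in> space ?R. (X \<omega>, scale_marks m n (X \<omega>) v) \<in> C} \<partial>M)"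
      by (rule emeasure_of_cond_distr[OF M R.prob_space_axioms U_cond[folded X_def Y_def]
            measurable_scale_marks marks_kernel_eq C])
    also have "\<dots> = (\<integral>\<^sup>+\<omega>. (\<Prod>j\<in>{2..n}. ennreal (\<psi> j \<omega> ^ count_list ws j * (1 - \<psi> j \<omega>) ^ overjumps m ws j)) \<partial>M)"
    proof (rule nn_integral_cong_AE)
      show "AE \<omega> in M. emeasure ?R {v \<in> space ?R. (X \<omega>, scale_marks m n (X \<omega>) v) \<in> C} =
          (\<Prod>j\<in>{2..n}. ennreal (\<psi> j \<omega> ^ count_list ws j * (1 - \<psi> j \<omega>) ^ overjumps m ws j))"
        using AE_generic AE_space
      proof eventually_elim
        case (elim \<omega>)
        let ?p = "X \<omega>"
        have p: "?p \<in> space ?P" using measurable_space[OF X elim(2)] .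
        have "scale_marks m n ?p v \<in> space ?L" for v
          by (simp add: scale_marks_def space_PiM)
        then have "{v \<in> space ?R. (?p, scale_marks m n ?p v) \<in> C} =
            {v \<in> space ?R. hits m n ws ?p (scale_marks m n ?p v)}"
          using p by (auto simp: C_def space_pair_measure)
        then have "emeasure ?R {v \<in> space ?R. (?p, scale_marks m n ?p v) \<in> C} =
            ennreal (\<Prod>j\<in>{2..n}. ?p j ^ count_list ws j * (1 - ?p j) ^ overjumps m ws j)"
          unfolding R.emeasure_eq_measure
          using elim(1) prob_hits[OF m0 elim(1) val len] prod_over_history[of ?p m ws n] val len
          by (simp add: generic_def)
        also have "\<dots> = (\<Prod>j\<in>{2..n}. ennreal (?p j ^ count_list ws j * (1 - ?p j) ^ overjumps m ws j))"
          using elim(1) by (intro prod_ennreal[symmetric]) (auto simp: generic_def less_imp_le)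
        also have "\<dots> = (\<Prod>j\<in>{2..n}. ennreal (\<psi> j \<omega> ^ count_list ws j * (1 - \<psi> j \<omega>) ^ overjumps m ws j))"
          by (intro prod.cong) (auto simp: X_def)
        finally show ?case .
      qed
    qed
    also have "\<dots> = ennreal (moment m u n ws)"
      unfolding moment_def
      using m0 u0 by (intro M.nn_integral_beta_monomials psi_indep psi_beta add_pos_nonneg mult_pos_pos) auto
    also have "moment m u n ws = pmf (history_pmf m \<alpha> ?N) ws"
      using pmf_history[OF m0 \<alpha> u val, of n] len by simp
    finally show ?thesis by (simp add: M.emeasure_eq_measure)
  qed

  have finW: "finite W"
  proof -
    have "W \<subseteq> {ws. set ws \<subseteq> {..n} \<and> length ws = ?N}"
    proof
      fix ws assume ws: "ws \<in> W"
      have "ws ! s \<le> n" if "s < ?N" for s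
        using ws that source_vertex_le[OF that] unfolding W_def admissible_def by force
      with ws show "ws \<in> {ws. set ws \<subseteq> {..n} \<and> length ws = ?N}"
        by (auto simp: W_def in_set_conv_nth)
    qed
    then show ?thesis by (rule finite_subset) (intro finite_lists_length_eq finite_atMost)
  qed

  \<comment> \<open>Every history with a graph in \<open>G\<close> contributes its event to the event that the urn graph is in \<open>G\<close>.\<close>
  have "distr M (count_space UNIV) gph =
      measure_pmf (map_pmf (history_graph m) (history_pmf m \<alpha> ?N))"
  proof (rule prob_measure_eqI)
    show "prob_space (distr M (count_space UNIV) gph)" by (rule M.prob_space_distr) measurable
    show "prob_space (measure_pmf (map_pmf (history_graph m) (history_pmf m \<alpha> ?N)))"
      by (rule prob_space_measure_pmf)
    fix G :: "multigraph set"
    let ?V = "{ws \<in> W. history_graph m ws \<in> G}"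
    have "measure_pmf.prob (map_pmf (history_graph m) (history_pmf m \<alpha> ?N)) G =
        measure_pmf.prob (history_pmf m \<alpha> ?N) (history_graph m -` G \<inter> set_pmf (history_pmf m \<alpha> ?N))"
      by (simp add: measure_Int_set_pmf)
    also have "\<dots> \<le> measure_pmf.prob (history_pmf m \<alpha> ?N) ?V"
      using history_support[OF m0 \<alpha>] by (intro measure_pmf.finite_measure_mono) (auto simp: W_def)
    also have "\<dots> = (\<Sum>ws\<in>?V. M.prob (E ws))"
      using finW by (simp add: measure_measure_pmf_finite E_prob)
    also have "\<dots> = M.prob (\<Union>ws\<in>?V. E ws)"
    proof (rule M.finite_measure_finite_Union[symmetric])
      show "disjoint_family_on E ?V"
        unfolding disjoint_family_on_def
      proof (intro ballI impI equals0I)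
        fix ws ws' \<omega> assume "ws \<in> ?V" "ws' \<in> ?V" "ws \<noteq> ws'" "\<omega> \<in> E ws \<inter> E ws'"
        then show False
          using hits_unique[of n "X \<omega>" m ws ws' "Y \<omega>"] by (auto simp: E_def W_def)
      qed
    qed (use finW E_sets in auto)
    also have "\<dots> \<le> M.prob (gph -` G \<inter> space M)"
    proof (rule M.finite_measure_mono)
      show "(\<Union>ws\<in>?V. E ws) \<subseteq> gph -` G \<inter> space M"
        using urn_graph_eq_history_graph[OF m0] by (auto simp: E_def W_def gph_eq)
    qed (use measurable_sets[OF gph, of G] in simp)
    also have "\<dots> = measure (distr M (count_space UNIV) gph) G"
      by (simp add: measure_distr)
    finally show "measure_pmf.prob (map_pmf (history_graph m) (history_pmf m \<alpha> ?N)) G \<le>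
        measure (distr M (count_space UNIV) gph) G" .
  qed simp
  then show ?thesis
    by (simp add: gph_def seq_pa_graph_eq_history[OF m0 \<alpha>])
qed

end
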